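(* Let $0<\alpha<mn$, let $1<s\le\infty$ with conjugate exponent $s'$ (so $\frac1s+\frac1{s'}=1$) satisfying $1\le s'<\frac{mn}{\alpha}$, and let $\Omega$ be homogeneous of degree zero on $\mathbb{R}^{mn}$ with $\Omega\in L^{s}(S^{mn-1})$. Let $(u,\upsilon)$ be a pair of weights on $\mathbb{R}^n$, and let $p$ and $p_1,\dots,p_m$ satisfy $s'<p_i<mp<\infty$ for every $i=1,\dots,m$. Suppose that for each $i=1,\dots,m$ there exist $r_i>1$ and a constant $C>0$ such that for every cube $Q$ in $\mathbb{R}^n$, $$|Q|^{\frac{s'}{mp}+\frac{\alpha s'}{mn}-\frac{s'}{p_i}}\left(\frac1{|Q|}\int_Q u(x)^{r_i}\,dx\right)^{\frac{s'}{r_i mp}}\left(\frac1{|Q|}\int_Q\upsilon(x)^{r_i\left(1-\left(\frac{p_i}{s'}\right)'\right)}dx\right)^{\frac{1}{r_i\left(\frac{p_i}{s'}\right)'}}\le C.$$ Then there is a constant $C>0$ such that for arbitrary $f_i\in L^{p_i}_{\upsilon}(\mathbb{R}^n)$, $i=1,\dots,m$ (with $C$ independent of the $f_i$), $$\left\|I_{\Omega,\alpha}^{(m)}(\overrightarrow{f})\right\|_{L^{p}_{u}(\mathbb{R}^n)}\le C\prod_{i=1}^m\|f_i\|_{L^{p_i}_{\upsilon}(\mathbb{R}^n)}.$$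
   Context: $n\ge 2$ and $m\ge1$ are integers. Write $\overrightarrow{y}=(y_1,\dots,y_m)\in(\mathbb{R}^n)^m=\mathbb{R}^{mn}$, $d\overrightarrow{y}=dy_1\cdots dy_m$, $|\overrightarrow{y}|=|y_1|+\cdots+|y_m|$, and $\overrightarrow{f}=(f_1,\dots,f_m)$. $S^{mn-1}$ is the unit sphere of $\mathbb{R}^{mn}$ with surface measure. "$\Omega$ is homogeneous of degree zero" means $\Omega(\lambda\overrightarrow{y})=\Omega(\overrightarrow{y})$ for all $\lambda>0$, $\overrightarrow{y}\ne0$. The rough multilinear fractional integral operator is $$I_{\Omega,\alpha}^{(m)}(\overrightarrow{f})(x)=\int_{(\mathbb{R}^n)^m}\frac{\Omega(\overrightarrow{y})}{|\overrightarrow{y}|^{mn-\alpha}}\prod_{i=1}^m f_i(x-y_i)\,d\overrightarrow{y},\qquad x\in\mathbb{R}^n.$$ A weight is a nonnegative locally integrable function on $\mathbb{R}^n$ that is positive a.e. Cubes have sides parallel to the coordinate axes. For $a>1$, $a'=\frac{a}{a-1}$; in particular $\left(\frac{p_i}{s'}\right)'$ is the conjugate exponent of $\frac{p_i}{s'}$. For a weight $v$ and $0<p<\infty$, $\|g\|_{L^p_v}=\left(\int_{\mathbb{R}^n}|g(x)|^p v(x)\,dx\right)^{1/p}$. *)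

theory Defs
  imports "HOL-Analysis.Analysis"
begin

text \<open>Real powers of elements of \<open>[0, \<infinity>]\<close>. Only used for exponents \<open>a > 0\<close>, hence \<open>\<infinity>\<^sup>a = \<infinity>\<close>.\<close>

definition epowr :: "ennreal \<Rightarrow> real \<Rightarrow> ennreal" (infixr "epowr" 80) where
  "x epowr a = (if x = \<infinity> then \<infinity> else ennreal (enn2real x powr a))"

definition conj_exponent :: "real \<Rightarrow> real" where
  "conj_exponent a = a / (a - 1)"

text \<open>
  Surface measure on the unit sphere of \<open>\<real>\<^sup>N\<close> in its polar-coordinate form:
  \<open>\<sigma>(A) = N \<cdot> vol {x. 0 < |x| < 1, x / |x| \<in> A}\<close> for Borel \<open>A\<close>, completed.
  Note that \<open>sgn x = x / |x|\<close> in a normed space.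
\<close>

definition sphere_measure :: "'a::euclidean_space measure" where
  "sphere_measure = completion (scale_measure (ennreal (real DIM('a)))
     (distr (restrict_space lebesgue (ball 0 1 - {0})) (restrict_space borel (sphere 0 1)) sgn))"

lemma space_sphere_measure: "space (sphere_measure :: 'a::euclidean_space measure) = sphere 0 1"
  by (simp add: sphere_measure_def space_restrict_space space_scale_measure)

lemma emeasure_sphere_measure:
  fixes A :: "'a::euclidean_space set"
  assumes "A \<in> sets borel" "A \<subseteq> sphere 0 1"
  shows "emeasure sphere_measure A =
    ennreal (real DIM('a)) * emeasure lebesgue {x \<in> ball 0 1 - {0}. sgn x \<in> A}"
proof -
  let ?M = "restrict_space lebesgue (ball 0 1 - {0}) :: 'a measure"
  let ?S = "restrict_space borel (sphere 0 1) :: 'a measure"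
  have "(\<lambda>x::'a. sgn x) \<in> borel_measurable lborel"
    unfolding sgn_div_norm by measurable
  then have "sgn \<in> borel_measurable (lebesgue :: 'a measure)"
    by (simp add: measurable_completion)
  then have "sgn \<in> borel_measurable ?M"
    by (rule measurable_restrict_space1)
  then have sgn: "sgn \<in> measurable ?M ?S"
    by (rule measurable_restrict_space2[rotated]) (auto simp: space_restrict_space norm_sgn)
  have A: "A \<in> sets ?S"
    using assms by (simp add: sets_restrict_space_iff)
  have "sgn -` A \<inter> space ?M = {x \<in> ball 0 1 - {0}. sgn x \<in> A}"
    by (auto simp: space_restrict_space)
  moreover have "emeasure ?M B = emeasure lebesgue B" if "B \<subseteq> ball 0 1 - {0}" for B :: "'a set"
    using that by (intro emeasure_restrict_space) auto
  ultimately have "emeasure (distr ?M ?S sgn) A = emeasure lebesgue {x \<in> ball 0 1 - {0}. sgn x \<in> A}"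
    using emeasure_distr[OF sgn A] by auto
  then show ?thesis
    using A by (simp add: sphere_measure_def)
qed

definition in_Lebesgue_space :: "ennreal \<Rightarrow> 'a measure \<Rightarrow> ('a \<Rightarrow> complex) \<Rightarrow> bool" where
  "in_Lebesgue_space s M f \<longleftrightarrow> f \<in> borel_measurable M \<and>
     (if s = \<infinity> then \<exists>B::real. AE x in M. norm (f x) \<le> B
      else (\<integral>\<^sup>+x. ennreal (norm (f x) powr enn2real s) \<partial>M) < \<infinity>)"

definition homogeneous_deg_zero :: "('a::real_vector \<Rightarrow> 'b) \<Rightarrow> bool" where
  "homogeneous_deg_zero \<Omega> \<longleftrightarrow> (\<forall>c>0. \<forall>y. y \<noteq> 0 \<longrightarrow> \<Omega> (c *\<^sub>R y) = \<Omega> y)"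

definition weight :: "('a::euclidean_space \<Rightarrow> real) \<Rightarrow> bool" where
  "weight w \<longleftrightarrow> (\<forall>x. 0 \<le> w x) \<and> (AE x in lebesgue. 0 < w x) \<and>
     (\<forall>K. compact K \<longrightarrow> set_integrable lebesgue K w)"

definition weighted_norm :: "real \<Rightarrow> ('a::euclidean_space \<Rightarrow> real) \<Rightarrow> ('a \<Rightarrow> complex) \<Rightarrow> ennreal" where
  "weighted_norm p v g = (\<integral>\<^sup>+x. ennreal (norm (g x) powr p * v x) \<partial>lebesgue) epowr (1 / p)"

definition weighted_Lp :: "real \<Rightarrow> ('a::euclidean_space \<Rightarrow> real) \<Rightarrow> ('a \<Rightarrow> complex) set" where
  "weighted_Lp p v = {g \<in> borel_measurable lebesgue. weighted_norm p v g < \<infinity>}"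

definition cubes :: "(real ^ 'n) set set" where
  "cubes = {cbox a (\<chi> i. a $ i + l) | a l. l > 0}"

definition average :: "(real ^ 'n) set \<Rightarrow> (real ^ 'n \<Rightarrow> real) \<Rightarrow> ennreal" where
  "average Q g = (\<integral>\<^sup>+x\<in>Q. ennreal (g x) \<partial>lebesgue) / emeasure lebesgue Q"

text \<open>
  A point of \<open>(\<real>\<^sup>n)\<^sup>m\<close> is \<open>y :: real ^ 'n ^ 'm\<close>, with components \<open>y $ i :: real ^ 'n\<close>; the
  Euclidean structure and Lebesgue measure of this type are those of \<open>\<real>\<^sup>m\<^sup>n\<close>. The quantity
  \<open>|y\<^sub>1| + \<dots> + |y\<^sub>m|\<close> in the kernel is not the Euclidean norm of \<open>y\<close>.
\<close>

definition sum_norm :: "real ^ 'n ^ 'm \<Rightarrow> real" where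
  "sum_norm y = (\<Sum>i\<in>UNIV. norm (y $ i))"

definition frac_integrand ::
  "(real ^ 'n ^ 'm \<Rightarrow> complex) \<Rightarrow> real \<Rightarrow> ('m \<Rightarrow> real ^ 'n \<Rightarrow> complex) \<Rightarrow>
   real ^ 'n \<Rightarrow> real ^ 'n ^ 'm \<Rightarrow> complex" where
  "frac_integrand \<Omega> \<alpha> f x y =
     \<Omega> y / complex_of_real (sum_norm y powr (real CARD('m) * real CARD('n) - \<alpha>)) *
     (\<Prod>i\<in>UNIV. f i (x - y $ i))"

definition frac_integral ::
  "(real ^ 'n ^ 'm \<Rightarrow> complex) \<Rightarrow> real \<Rightarrow> ('m \<Rightarrow> real ^ 'n \<Rightarrow> complex) \<Rightarrow> real ^ 'n \<Rightarrow> complex" where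
  "frac_integral \<Omega> \<alpha> f x = (\<integral>y. frac_integrand \<Omega> \<alpha> f x y \<partial>lebesgue)"

end

theory Submission
  imports Defs
begin

text \<open>
  Decomposing the kernel into the shells \<open>|y| \<approx> 2\<^sup>j\<close> and applying Hoelder's inequality with \<open>\<Omega> \<in> L\<^sup>s\<close>
  on each of them bounds the operator by \<open>\<Sum>\<^sub>j \<Prod>\<^sub>i (2\<^sup>a\<^sup>j avg\<^sub>j g\<^sub>i)\<^bsup>1/s'\<^esup>\<close>, where \<open>g\<^sub>i = |f\<^sub>i|\<^bsup>s'\<^esup>\<close>, \<open>a = \<alpha>s'/m\<close>
  and \<open>avg\<^sub>j\<close> is the average over a cube of side \<open>\<approx> 2\<^sup>j\<close>. Each factor is then a linear two-weight
  problem with exponents \<open>P\<^sub>i = p\<^sub>i/s' < R = mp/s'\<close>. Since these inequalities are strict, \<open>R\<close> and \<open>a\<close>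
  can be perturbed to both sides; the pointwise interpolation of Welland and Hoelder's inequality
  with \<open>2m\<close> factors then leave only the \<open>\<ell>\<^sup>R\<close>-sums \<open>\<Sum>\<^sub>j (2\<^sup>a\<^sup>j avg\<^sub>j g)\<^sup>R\<close> to be estimated. For those the
  hypothesis on the weights removes \<open>u\<close> and \<open>\<upsilon>\<close> scale by scale, at the price of the averages
  \<open>(avg\<^sub>j G\<^sup>t)\<^bsup>1/t\<^esup>\<close> of \<open>G = g \<upsilon>\<^bsup>1/P\<^esup> \<in> L\<^sup>P\<close> with \<open>t < P\<close>, and the remaining unweighted sum over \<open>j\<close> is
  elementary because \<open>t < P < R\<close>. No maximal theorem is needed.
\<close>

subsection \<open>Powers in the extended nonnegative reals\<close>

text \<open>The scales have to be summed in the first power, whereas the weight hypothesis acts on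
  one cube at a time and gives control only in the power R. The interpolation bridges this gap: for
  each of the two perturbed orders it needs one bound valid at all scales, and a sum of powers
  bounds each of its terms. A supremum, that is a maximal function, would be the usual choice at
  this place. The bumps \<open>r i\<close> > 1 are spent twice. On the side of \<upsilon> the
  exponent r P' exceeds P', so its conjugate t lies strictly below P. On the side of u, the exponent
  above R turns u into a slightly higher power of itself, whose averages are still dominated by the
  bumped averages of u. The estimates are carried out for nonnegative Borel integrands with values
  in [0, \<infinity>], where Tonelli's theorem needs no integrability. Absolute convergence of the
  integral that defines the operator is therefore a consequence of the estimate and not a
  prerequisite.\<close>

lemma ennreal_epowr: "0 \<le> x \<Longrightarrow> ennreal x epowr a = ennreal (x powr a)"
  by (simp add: epowr_def)

lemma zero_epowr [simp]: "0 epowr a = 0"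
  by (simp add: epowr_def)

lemma top_epowr [simp]: "top epowr a = top"
  by (simp add: epowr_def)

lemma one_epowr [simp]: "1 epowr a = 1"
  by (simp add: epowr_def)

lemma epowr_one [simp]: "x epowr 1 = x"
  by (cases x rule: ennreal_cases) (auto simp: ennreal_epowr)

lemma epowr_eq_0_iff [simp]: "x epowr a = 0 \<longleftrightarrow> x = 0"
  by (cases x rule: ennreal_cases) (auto simp: ennreal_epowr)

lemma epowr_eq_top_iff [simp]: "x epowr a = top \<longleftrightarrow> x = top"
  by (auto simp: epowr_def)

lemma epowr_mono: "x \<le> y \<Longrightarrow> 0 \<le> a \<Longrightarrow> x epowr a \<le> y epowr a"
  by (cases x rule: ennreal_cases; cases y rule: ennreal_cases)
     (auto simp: ennreal_epowr top_unique intro!: powr_mono2 ennreal_leI)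

text \<open>No sign condition on the exponent: \<open>0\<close> and \<open>top\<close> are fixed by
  every power, and \<open>0 * top = 0\<close> is respected on both sides. The same convention makes
  \<open>epowr_add\<close> and \<open>epowr_epowr\<close> unconditional.\<close>

lemma epowr_mult: "(x * y) epowr a = x epowr a * y epowr a"
proof (cases x rule: ennreal_cases)
  case (real r)
  note x = this
  show ?thesis
  proof (cases y rule: ennreal_cases)
    case (real t)
    then show ?thesis
      using x by (simp add: ennreal_epowr powr_mult flip: ennreal_mult)
  next
    case top
    then show ?thesis
      by (cases "x = 0") (auto simp: ennreal_mult_top)
  qed
next
  case top
  then show ?thesis
    by (cases "y = 0") (auto simp: ennreal_top_mult)
qed

lemma epowr_add: "x epowr a * x epowr b = x epowr (a + b)"
  by (cases x rule: ennreal_cases)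
     (auto simp: ennreal_epowr powr_add ennreal_top_mult simp flip: ennreal_mult)

lemma epowr_epowr: "(x epowr a) epowr b = x epowr (a * b)"
  by (cases x rule: ennreal_cases) (auto simp: ennreal_epowr powr_powr)

lemma prod_epowr: "(\<Prod>i\<in>I. f i) epowr a = (\<Prod>i\<in>I. f i epowr a)"
  by (induction I rule: infinite_finite_induct) (auto simp: epowr_mult)

text \<open>Nonemptiness matters: the empty product is 1, but \<open>0 epowr 0\<close> is 0 and
  \<open>top epowr 0\<close> is \<open>top\<close>.\<close>

lemma epowr_sum:
  assumes "finite I" "I \<noteq> {}"
  shows "(\<Prod>i\<in>I. x epowr a i) = x epowr (\<Sum>i\<in>I. a i)"
  using assms by (induction rule: finite_ne_induct) (auto simp: epowr_add)

lemma epowr_le_iff_le_epowr: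
  assumes "0 < a"
  shows "x epowr a \<le> y \<longleftrightarrow> x \<le> y epowr (1 / a)"
proof
  assume "x epowr a \<le> y"
  from epowr_mono[OF this, of "1 / a"] show "x \<le> y epowr (1 / a)"
    using assms by (simp add: epowr_epowr)
next
  assume "x \<le> y epowr (1 / a)"
  from epowr_mono[OF this, of a] show "x epowr a \<le> y"
    using assms by (simp add: epowr_epowr)
qed

lemma borel_measurable_epowr [measurable]:
  "f \<in> borel_measurable M \<Longrightarrow> (\<lambda>x. f x epowr a) \<in> borel_measurable M"
  unfolding epowr_def by measurable auto

lemma epowr_less_top_iff [simp]: "x epowr a < top \<longleftrightarrow> x < top"
  by (simp add: less_top[symmetric])

text \<open>From x + y \<le> 2 max x y. This crude constant serves all exponents alike, whereas 2
  powr (a - 1) would require convexity and hence a \<ge> 1.\<close>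

lemma add_epowr_le:
  assumes "0 \<le> a"
  shows "(x + y) epowr a \<le> ennreal (2 powr a) * (x epowr a + y epowr a)"
proof -
  have "x + y \<le> 2 * max x y"
    by (metis add_mono max.cobounded1 max.cobounded2 mult_2)
  then have "(x + y) epowr a \<le> (2 * max x y) epowr a"
    by (rule epowr_mono[OF _ assms])
  also have "\<dots> = ennreal (2 powr a) * (max x y) epowr a"
    unfolding epowr_mult using ennreal_epowr[of 2 a] by simp
  also have "(max x y) epowr a \<le> x epowr a + y epowr a"
    by (auto simp: max_def)
  finally show ?thesis
    by (simp add: mult_left_mono)
qed

subsection \<open>Hoelder's inequality\<close>

text \<open>Jensen's inequality for exp at the points ln (x i), once the case of a vanishing factor
  is split off.\<close>

lemma weighted_AM_GM_real:
  fixes x \<theta> :: "'i \<Rightarrow> real"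
  assumes "finite I" "\<And>i. i \<in> I \<Longrightarrow> 0 < \<theta> i" "(\<Sum>i\<in>I. \<theta> i) = 1" "\<And>i. i \<in> I \<Longrightarrow> 0 \<le> x i"
  shows "(\<Prod>i\<in>I. x i powr \<theta> i) \<le> (\<Sum>i\<in>I. \<theta> i * x i)"
proof (cases "\<exists>i\<in>I. x i = 0")
  case True
  then have "(\<Prod>i\<in>I. x i powr \<theta> i) = 0"
    using assms(1) by (auto intro!: prod_zero)
  also have "0 \<le> (\<Sum>i\<in>I. \<theta> i * x i)"
    using assms by (intro sum_nonneg mult_nonneg_nonneg) (auto intro: less_imp_le)
  finally show ?thesis .
next
  case False
  then have pos: "0 < x i" if "i \<in> I" for i
    using assms(4)[OF that] that by force
  have "I \<noteq> {}"
    using assms(3) by auto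
  have "exp (\<Sum>i\<in>I. \<theta> i *\<^sub>R ln (x i)) \<le> (\<Sum>i\<in>I. \<theta> i * exp (ln (x i)))"
    using assms \<open>I \<noteq> {}\<close> by (intro convex_on_sum[OF _ _ exp_convex]) (auto intro: less_imp_le)
  also have "exp (\<Sum>i\<in>I. \<theta> i *\<^sub>R ln (x i)) = (\<Prod>i\<in>I. x i powr \<theta> i)"
    unfolding exp_sum[OF assms(1)] using pos
    by (intro prod.cong refl) (auto simp: powr_def order_less_imp_not_eq2)
  finally show ?thesis
    using pos by simp
qed

lemma weighted_AM_GM_ennreal:
  fixes x :: "'i \<Rightarrow> ennreal" and \<theta> :: "'i \<Rightarrow> real"
  assumes "finite I" "\<And>i. i \<in> I \<Longrightarrow> 0 < \<theta> i" "(\<Sum>i\<in>I. \<theta> i) = 1"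
  shows "(\<Prod>i\<in>I. x i epowr \<theta> i) \<le> (\<Sum>i\<in>I. ennreal (\<theta> i) * x i)"
proof (cases "\<exists>i\<in>I. x i = top")
  case True
  then obtain i where i: "i \<in> I" "x i = top"
    by auto
  then have "ennreal (\<theta> i) * x i = top"
    using assms(2)[of i] by (simp add: ennreal_mult_top)
  moreover have "ennreal (\<theta> i) * x i \<le> (\<Sum>i\<in>I. ennreal (\<theta> i) * x i)"
    using i assms(1) by (intro member_le_sum) auto
  ultimately show ?thesis
    by (simp add: top_unique)
next
  case False
  define y where "y i = enn2real (x i)" for i
  have x: "x i = ennreal (y i)" if "i \<in> I" for i
    using False that by (auto simp: y_def less_top)
  have y: "0 \<le> y i" for i
    by (simp add: y_def)
  have "(\<Prod>i\<in>I. x i epowr \<theta> i) = ennreal (\<Prod>i\<in>I. y i powr \<theta> i)"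
    by (simp add: x ennreal_epowr y prod_ennreal)
  also have "\<dots> \<le> ennreal (\<Sum>i\<in>I. \<theta> i * y i)"
    using assms y by (intro ennreal_leI weighted_AM_GM_real) auto
  also have "\<dots> = (\<Sum>i\<in>I. ennreal (\<theta> i) * x i)"
    using assms(2) y by (simp add: x less_imp_le sum_ennreal[symmetric] ennreal_mult)
  finally show ?thesis .
qed

text \<open>Hoelder's inequality for finitely many factors: normalise every \<open>F i\<close> to
  integral 1 and integrate the pointwise inequality of weighted means. A vanishing integral is
  treated before an infinite one, because \<open>0 * top = 0\<close> decides the right-hand side
  when both occur.\<close>

lemma nn_integral_prod_epowr_le:
  fixes F :: "'i \<Rightarrow> 'a \<Rightarrow> ennreal"
  assumes "finite I" "\<And>i. i \<in> I \<Longrightarrow> 0 < \<theta> i" "(\<Sum>i\<in>I. \<theta> i) = 1"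
    and F [measurable]: "\<And>i. i \<in> I \<Longrightarrow> F i \<in> borel_measurable M"
  shows "(\<integral>\<^sup>+x. (\<Prod>i\<in>I. F i x epowr \<theta> i) \<partial>M) \<le> (\<Prod>i\<in>I. (\<integral>\<^sup>+x. F i x \<partial>M) epowr \<theta> i)"
proof -
  define c where "c i = (\<integral>\<^sup>+x. F i x \<partial>M)" for i
  consider (zero) i where "i \<in> I" "c i = 0" | (top) i where "i \<in> I" "c i = top" "\<forall>i\<in>I. c i \<noteq> 0"
    | (fin) "\<forall>i\<in>I. c i \<noteq> 0 \<and> c i \<noteq> top"
    by blast
  then show ?thesis
  proof cases
    case zero
    then have "AE x in M. F i x = 0"
      using F by (simp add: c_def nn_integral_0_iff_AE)
    then have "AE x in M. (\<Prod>i\<in>I. F i x epowr \<theta> i) = 0"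
      by (rule AE_mp) (use zero(1) assms(1) in \<open>auto\<close>)
    then have "(\<integral>\<^sup>+x. (\<Prod>i\<in>I. F i x epowr \<theta> i) \<partial>M) = 0"
      by (subst nn_integral_0_iff_AE) auto
    then show ?thesis
      by simp
  next
    case top
    have "(\<Prod>i\<in>I. c i epowr \<theta> i) = c i epowr \<theta> i * (\<Prod>i\<in>I - {i}. c i epowr \<theta> i)"
      using top(1) assms(1) by (simp add: prod.remove)
    also have "\<dots> = top"
      using top assms(1) by (simp add: ennreal_top_mult)
    finally show ?thesis
      by (simp add: c_def)
  next
    case fin
    define K where "K = (\<Prod>i\<in>I. c i epowr \<theta> i)"
    have "(\<integral>\<^sup>+x. (\<Prod>i\<in>I. F i x epowr \<theta> i) \<partial>M)
      \<le> (\<integral>\<^sup>+x. K * (\<Sum>i\<in>I. ennreal (\<theta> i) * (F i x / c i)) \<partial>M)"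
    proof (rule nn_integral_mono)
      fix x
      have "(\<Prod>i\<in>I. F i x epowr \<theta> i) = (\<Prod>i\<in>I. (c i * (F i x / c i)) epowr \<theta> i)"
        using fin by (intro prod.cong refl) (simp add: ennreal_times_divide mult.commute[of "c _"] ennreal_mult_divide_eq)
      also have "\<dots> = K * (\<Prod>i\<in>I. (F i x / c i) epowr \<theta> i)"
        by (simp add: epowr_mult K_def prod.distrib)
      also have "\<dots> \<le> K * (\<Sum>i\<in>I. ennreal (\<theta> i) * (F i x / c i))"
        using assms by (intro mult_left_mono weighted_AM_GM_ennreal) auto
      finally show "(\<Prod>i\<in>I. F i x epowr \<theta> i) \<le> K * (\<Sum>i\<in>I. ennreal (\<theta> i) * (F i x / c i))" .
    qed
    also have "\<dots> = K * (\<Sum>i\<in>I. ennreal (\<theta> i) * (c i / c i))"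
      by (simp add: nn_integral_cmult nn_integral_sum nn_integral_divide c_def)
    also have "\<dots> = K * (\<Sum>i\<in>I. ennreal (\<theta> i))"
      using fin by (simp add: less_top)
    also have "\<dots> = K"
      using assms(2,3) by (subst sum_ennreal) (auto intro: less_imp_le)
    finally show ?thesis
      by (simp add: K_def c_def)
  qed
qed

lemma nn_integral_mult_epowr_le:
  fixes f g :: "'a \<Rightarrow> ennreal"
  assumes "0 < a" "0 < b" "a + b = 1"
    and [measurable]: "f \<in> borel_measurable M" "g \<in> borel_measurable M"
  shows "(\<integral>\<^sup>+x. f x epowr a * g x epowr b \<partial>M) \<le> (\<integral>\<^sup>+x. f x \<partial>M) epowr a * (\<integral>\<^sup>+x. g x \<partial>M) epowr b"
proof -
  have "(\<integral>\<^sup>+x. (\<Prod>i\<in>UNIV. (if i then f else g) x epowr (if i then a else b)) \<partial>M)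
    \<le> (\<Prod>i\<in>UNIV. (\<integral>\<^sup>+x. (if i then f else g) x \<partial>M) epowr (if i then a else b))"
    using assms by (intro nn_integral_prod_epowr_le) (auto simp: UNIV_bool)
  then show ?thesis
    by (simp add: UNIV_bool mult.commute)
qed

subsection \<open>Geometric sums over the integers\<close>

text \<open>Sums over scales are integrals against the counting measure on the integers, so that
  Tonelli's theorem and monotonicity apply to them. Measurability in the parameter comes from
  enumerating the integers and reading the integral as a series.\<close>

lemma borel_measurable_nn_integral_count_space_int [measurable (raw)]:
  fixes f :: "'a \<Rightarrow> int \<Rightarrow> ennreal"
  assumes [measurable]: "\<And>j. (\<lambda>x. f x j) \<in> borel_measurable M"
  shows "(\<lambda>x. \<integral>\<^sup>+j. f x j \<partial>count_space UNIV) \<in> borel_measurable M"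
proof -
  have "(\<integral>\<^sup>+j. f x j \<partial>count_space UNIV) = (\<Sum>n. f x (int_decode n))" for x
    by (subst nn_integral_bij_count_space[OF bij_int_decode, symmetric]) (rule nn_integral_count_space_nat)
  then show ?thesis
    by simp
qed

lemma nn_integral_count_space_int_uminus:
  "(\<integral>\<^sup>+j. f (- j) \<partial>count_space UNIV) = (\<integral>\<^sup>+j. f (j::int) \<partial>count_space UNIV)"
  by (rule nn_integral_bij_count_space) (auto intro!: bij_betwI[where g = uminus])

text \<open>The admissible j form a half-line with largest element \<open>k\<close>. Counted
  downwards from \<open>k\<close>, the terms are a geometric series of ratio 2 powr - \<beta> whose
  first term is at most X.\<close>

lemma nn_integral_geometric_pos:
  assumes "0 < \<beta>" "0 < c" "0 < X"
  shows "(\<integral>\<^sup>+j. ennreal (c * 2 powr (\<beta> * of_int j)) * indicator {j. c * 2 powr (\<beta> * of_int j) \<le> X} j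
      \<partial>count_space (UNIV :: int set)) \<le> ennreal (X / (1 - 2 powr - \<beta>))"
proof -
  define k where "k = \<lfloor>log 2 (X / c) / \<beta>\<rfloor>"
  have le_iff: "c * 2 powr (\<beta> * of_int j) \<le> X \<longleftrightarrow> j \<le> k" for j :: int
  proof -
    have "c * 2 powr (\<beta> * of_int j) \<le> X \<longleftrightarrow> 2 powr (\<beta> * of_int j) \<le> X / c"
      using assms by (simp add: field_simps)
    also have "\<dots> \<longleftrightarrow> \<beta> * of_int j \<le> log 2 (X / c)"
      using assms by (intro powr_le_iff) auto
    also have "\<dots> \<longleftrightarrow> of_int j \<le> log 2 (X / c) / \<beta>"
      using assms by (simp add: field_simps)
    also have "\<dots> \<longleftrightarrow> j \<le> k"
      by (simp add: k_def le_floor_iff)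
    finally show ?thesis .
  qed
  have r: "0 < 2 powr - \<beta>" "2 powr - \<beta> < (1::real)"
    using assms by (auto simp: powr_less_one)
  have bij: "bij_betw (\<lambda>i::nat. k - int i) UNIV {..k}"
    by (rule bij_betwI[where g = "\<lambda>j. nat (k - j)"]) auto
  have "(\<integral>\<^sup>+j. ennreal (c * 2 powr (\<beta> * of_int j)) * indicator {j. c * 2 powr (\<beta> * of_int j) \<le> X} j
      \<partial>count_space (UNIV :: int set)) =
    (\<integral>\<^sup>+j. ennreal (c * 2 powr (\<beta> * of_int j)) \<partial>count_space {..k})"
    by (simp add: le_iff nn_integral_count_space_indicator atMost_def)
  also have "\<dots> = (\<integral>\<^sup>+i. ennreal (c * 2 powr (\<beta> * of_int (k - int i))) \<partial>count_space UNIV)"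
    using nn_integral_bij_count_space[OF bij, of "\<lambda>j. ennreal (c * 2 powr (\<beta> * of_int j))"] by simp
  also have "\<dots> = (\<Sum>i. ennreal (c * 2 powr (\<beta> * of_int k) * (2 powr - \<beta>) ^ i))"
    unfolding nn_integral_count_space_nat
    by (intro suminf_cong arg_cong[where f = ennreal])
       (simp add: right_diff_distrib powr_diff powr_minus power_inverse divide_inverse
         powr_powr flip: powr_realpow)
  also have "\<dots> = ennreal (c * 2 powr (\<beta> * of_int k) * (1 / (1 - 2 powr - \<beta>)))"
    using assms r by (intro suminf_ennreal_eq sums_mult geometric_sums) auto
  also have "\<dots> \<le> ennreal (X / (1 - 2 powr - \<beta>))"
    using le_iff[of k] r by (intro ennreal_leI) (simp add: divide_right_mono)
  finally show ?thesis .
qed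

text \<open>The reflection j -> -j exchanges the two signs of \<beta>. Both signs occur, since the
  sums over small and over large scales decay in opposite directions.\<close>

lemma nn_integral_geometric:
  assumes "\<beta> \<noteq> 0" "0 < c" "0 < X"
  shows "(\<integral>\<^sup>+j. ennreal (c * 2 powr (\<beta> * of_int j)) * indicator {j. c * 2 powr (\<beta> * of_int j) \<le> X} j
      \<partial>count_space (UNIV :: int set)) \<le> ennreal (X / (1 - 2 powr - \<bar>\<beta>\<bar>))"
proof (cases "0 < \<beta>")
  case True
  then show ?thesis
    using nn_integral_geometric_pos[of \<beta> c X] assms by simp
next
  case False
  have "(\<integral>\<^sup>+j. ennreal (c * 2 powr (- \<beta> * of_int j)) * indicator {j. c * 2 powr (- \<beta> * of_int j) \<le> X} j
      \<partial>count_space (UNIV :: int set)) \<le> ennreal (X / (1 - 2 powr - (- \<beta>)))"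
    using False assms by (intro nn_integral_geometric_pos) auto
  then show ?thesis
    using False nn_integral_count_space_int_uminus[of "\<lambda>j. ennreal (c * 2 powr (\<beta> * of_int j)) *
      indicator {j. c * 2 powr (\<beta> * of_int j) \<le> X} j"]
    by (simp add: indicator_def)
qed

text \<open>The pointwise interpolation of Welland and Hedberg: two bounds that gain on opposite ends of
  the scale are summed up to the scale where they balance.\<close>

lemma nn_integral_int_le_geometric_mean:
  fixes a :: "int \<Rightarrow> ennreal"
  assumes "0 < \<epsilon>"
    and X: "\<And>j. ennreal (2 powr (\<epsilon> * of_int j)) * a j \<le> X"
    and Y: "\<And>j. ennreal (2 powr (- \<epsilon> * of_int j)) * a j \<le> Y"
  shows "(\<integral>\<^sup>+j. a j \<partial>count_space UNIV)
    \<le> ennreal (2 / (1 - 2 powr - \<epsilon>)) * (X epowr (1 / 2) * Y epowr (1 / 2))"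
proof -
  have r: "2 powr - \<epsilon> < (1::real)"
    using assms by (auto simp: powr_less_one)
  have aX: "a j \<le> ennreal (2 powr (- \<epsilon> * of_int j)) * X" for j
  proof -
    have "a j = ennreal (2 powr (- \<epsilon> * of_int j)) * (ennreal (2 powr (\<epsilon> * of_int j)) * a j)"
      by (simp add: mult.assoc[symmetric] ennreal_mult[symmetric] powr_minus)
    then show ?thesis
      using X[of j] by (metis mult_left_mono zero_le)
  qed
  have aY: "a j \<le> ennreal (2 powr (\<epsilon> * of_int j)) * Y" for j
  proof -
    have "a j = ennreal (2 powr (\<epsilon> * of_int j)) * (ennreal (2 powr (- \<epsilon> * of_int j)) * a j)"
      by (simp add: mult.assoc[symmetric] ennreal_mult[symmetric] powr_minus)
    then show ?thesis
      using Y[of j] by (metis mult_left_mono zero_le)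
  qed
  consider "X = 0 \<or> Y = 0" | "X \<noteq> 0" "Y \<noteq> 0" "X = top \<or> Y = top"
    | "X \<noteq> 0" "Y \<noteq> 0" "X \<noteq> top" "Y \<noteq> top"
    by blast
  then show ?thesis
  proof cases
    case 1
    then have "a j = 0" for j
      using aX[of j] aY[of j] by auto
    then show ?thesis
      by simp
  next
    case 2
    then have "X epowr (1 / 2) * Y epowr (1 / 2) = top"
      by (auto simp: ennreal_top_mult ennreal_mult_top)
    then show ?thesis
      using r assms(1) by (simp add: ennreal_mult_top)
  next
    case 3
    obtain x where x: "X = ennreal x" "0 < x"
      using 3 by (cases X rule: ennreal_cases) (auto simp: less_le)
    obtain y where y: "Y = ennreal y" "0 < y"
      using 3 by (cases Y rule: ennreal_cases) (auto simp: less_le)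
    \<comment> \<open>The value of 2 powr (\<epsilon> j) at which the bounds 2 powr (\<epsilon> j) Y
      and 2 powr (- \<epsilon> j) X coincide.\<close>
    define T where "T = sqrt (x / y)"
    have T: "0 < T"
      using x y by (simp add: T_def)
    have Tx: "y * T = sqrt (x * y)" "x / T = sqrt (x * y)"
      using x y by (auto simp: T_def real_sqrt_divide real_sqrt_mult field_simps)
    \<comment> \<open>Every j lies on one side of the balance point and takes the bound that is
      small there. The factors \<open>1 *\<close> fit the constant \<open>c\<close> of
      \<open>nn_integral_geometric\<close>.\<close>
    have "a j \<le> Y * (ennreal (1 * 2 powr (\<epsilon> * of_int j)) * indicator {j. 1 * 2 powr (\<epsilon> * of_int j) \<le> T} j)
      + X * (ennreal (1 * 2 powr (- \<epsilon> * of_int j)) * indicator {j. 1 * 2 powr (- \<epsilon> * of_int j) \<le> 1 / T} j)" for j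
    proof (cases "2 powr (\<epsilon> * of_int j) \<le> T")
      case True
      then show ?thesis
        using aY[of j] by (intro add_increasing2) (auto simp: mult.commute)
    next
      case False
      then have "2 powr (- \<epsilon> * of_int j) \<le> 1 / T"
        using T by (simp add: powr_minus field_simps)
      then show ?thesis
        using aX[of j] by (intro add_increasing) (auto simp: mult.commute)
    qed
    then have "(\<integral>\<^sup>+j. a j \<partial>count_space UNIV) \<le> (\<integral>\<^sup>+j.
        Y * (ennreal (1 * 2 powr (\<epsilon> * of_int j)) * indicator {j. 1 * 2 powr (\<epsilon> * of_int j) \<le> T} j)
      + X * (ennreal (1 * 2 powr (- \<epsilon> * of_int j)) * indicator {j. 1 * 2 powr (- \<epsilon> * of_int j) \<le> 1 / T} j)
      \<partial>count_space UNIV)"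
      by (intro nn_integral_mono) auto
    also have "\<dots> =
      Y * (\<integral>\<^sup>+j. ennreal (1 * 2 powr (\<epsilon> * of_int j)) * indicator {j. 1 * 2 powr (\<epsilon> * of_int j) \<le> T} j
        \<partial>count_space UNIV) +
      X * (\<integral>\<^sup>+j. ennreal (1 * 2 powr (- \<epsilon> * of_int j)) * indicator {j. 1 * 2 powr (- \<epsilon> * of_int j) \<le> 1 / T} j
        \<partial>count_space UNIV)"
      by (subst nn_integral_add) (auto simp: nn_integral_cmult)
    also have "\<dots> \<le> Y * ennreal (T / (1 - 2 powr - \<bar>\<epsilon>\<bar>)) + X * ennreal ((1 / T) / (1 - 2 powr - \<bar>- \<epsilon>\<bar>))"
      using T assms by (intro add_mono mult_left_mono nn_integral_geometric) auto
    also have "\<dots> = ennreal (2 / (1 - 2 powr - \<epsilon>) * sqrt (x * y))"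
    proof -
      have "Y * ennreal (T / (1 - 2 powr - \<bar>\<epsilon>\<bar>)) = ennreal (sqrt (x * y) / (1 - 2 powr - \<epsilon>))"
        using x y T r assms by (simp flip: ennreal_mult Tx(1))
      moreover have "X * ennreal ((1 / T) / (1 - 2 powr - \<bar>- \<epsilon>\<bar>)) = ennreal (sqrt (x * y) / (1 - 2 powr - \<epsilon>))"
        using x y T r assms by (simp flip: ennreal_mult Tx(2))
      ultimately show ?thesis
        using x y r by (simp flip: ennreal_plus)
    qed
    also have "\<dots> = ennreal (2 / (1 - 2 powr - \<epsilon>)) * (X epowr (1 / 2) * Y epowr (1 / 2))"
      using x y r by (simp add: ennreal_epowr powr_half_sqrt real_sqrt_mult flip: ennreal_mult)
    finally show ?thesis .
  qed
qed

subsection \<open>Averages over cubes\<close>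

text \<open>A closed ball of the maximum norm, with side 2 \<rho>. Centring makes membership
  symmetric in point and centre, and the triangle inequality gives the passage to doubled
  cubes.\<close>

definition cube :: "real ^ 'n \<Rightarrow> real \<Rightarrow> (real ^ 'n) set" where
  "cube x \<rho> = cbox (x - vec \<rho>) (x + vec \<rho>)"

lemma mem_cube: "y \<in> cube x \<rho> \<longleftrightarrow> (\<forall>i. \<bar>y $ i - x $ i\<bar> \<le> \<rho>)"
  by (auto simp: cube_def mem_box_cart abs_le_iff algebra_simps)

lemma mem_cube_commute: "y \<in> cube x \<rho> \<longleftrightarrow> x \<in> cube y \<rho>"
  by (simp add: mem_cube abs_minus_commute)

lemma indicator_cube_commute: "indicator (cube x \<rho>) y = indicator (cube y \<rho>) x"
  by (simp add: indicator_def mem_cube_commute[of y])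

lemma cube_subset_cube_double: "z \<in> cube w \<rho> \<Longrightarrow> cube z \<rho> \<subseteq> cube w (2 * \<rho>)"
proof
  fix y assume "z \<in> cube w \<rho>" "y \<in> cube z \<rho>"
  then have *: "\<bar>y $ i - z $ i\<bar> \<le> \<rho>" "\<bar>z $ i - w $ i\<bar> \<le> \<rho>" for i
    by (auto simp: mem_cube)
  have "\<bar>y $ i - w $ i\<bar> \<le> 2 * \<rho>" for i
    using *[of i] by linarith
  then show "y \<in> cube w (2 * \<rho>)"
    by (simp add: mem_cube)
qed

lemma sets_cube [measurable]: "cube x \<rho> \<in> sets borel"
  by (simp add: cube_def)

lemma emeasure_cube:
  fixes x :: "real ^ 'n"
  assumes "0 \<le> \<rho>"
  shows "emeasure lborel (cube x \<rho>) = ennreal ((2 * \<rho>) ^ CARD('n))"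
proof -
  have "(vec \<rho> :: real ^ 'n) \<bullet> b = \<rho>" if "b \<in> Basis" for b
    using that by (auto simp: Basis_vec_def inner_axis)
  then have "((x + vec \<rho>) - (x - vec \<rho>)) \<bullet> b = 2 * \<rho>" if "b \<in> Basis" for b
    using that by (simp only: inner_diff_left inner_add_left)
  then have "(\<Prod>b\<in>Basis. ((x + vec \<rho>) - (x - vec \<rho>)) \<bullet> b) = (2 * \<rho>) ^ CARD('n)"
    by (simp del: add_diff_cancel_left)
  moreover have "(x - vec \<rho>) \<bullet> b \<le> (x + vec \<rho>) \<bullet> b" if "b \<in> Basis" for b
    using that assms \<open>\<And>b. b \<in> Basis \<Longrightarrow> vec \<rho> \<bullet> b = \<rho>\<close> by (simp add: inner_diff_left inner_add_left)
  ultimately show ?thesis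
    unfolding cube_def by (simp add: emeasure_lborel_cbox_eq)
qed

lemma measure_cube:
  fixes x :: "real ^ 'n"
  assumes "0 \<le> \<rho>"
  shows "measure lebesgue (cube x \<rho>) = (2 * \<rho>) ^ CARD('n)"
  using emeasure_cube[OF assms, of x] assms by (simp add: measure_def)

lemma cube_in_cubes: "0 < \<rho> \<Longrightarrow> cube x \<rho> \<in> cubes"
  unfolding cubes_def cube_def
  by (auto intro!: exI[of _ "x - vec \<rho>"] exI[of _ "2 * \<rho>"] arg_cong2[where f = cbox] simp: vec_eq_iff)

lemma measurable_indicator_cube [measurable]:
  "(\<lambda>(x, y). indicator (cube x \<rho>) y :: ennreal) \<in> borel_measurable (borel \<Otimes>\<^sub>M borel)"
proof -
  have "closed {p :: (real ^ 'n) \<times> (real ^ 'n). \<forall>i. \<bar>snd p $ i - fst p $ i\<bar> \<le> \<rho>}"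
    by (intro closed_Collect_all closed_Collect_le continuous_intros)
  then have "{p :: (real ^ 'n) \<times> (real ^ 'n). snd p \<in> cube (fst p) \<rho>} \<in> sets (borel \<Otimes>\<^sub>M borel)"
    unfolding mem_cube borel_prod by (rule borel_closed)
  then have "(indicator {p :: (real ^ 'n) \<times> (real ^ 'n). snd p \<in> cube (fst p) \<rho>} :: _ \<Rightarrow> ennreal)
      \<in> borel_measurable (borel \<Otimes>\<^sub>M borel)"
    by (rule borel_measurable_indicator)
  then show ?thesis
    by (simp add: indicator_def[abs_def] case_prod_unfold)
qed

lemma measurable_indicator_cube_comp [measurable (raw)]:
  assumes "f \<in> borel_measurable M" "g \<in> borel_measurable M"
  shows "(\<lambda>x. indicator (cube (f x) \<rho>) (g x) :: ennreal) \<in> borel_measurable M"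
  using measurable_compose[OF measurable_Pair[OF assms] measurable_indicator_cube] by simp

definition cube_avg :: "real \<Rightarrow> (real ^ 'n \<Rightarrow> ennreal) \<Rightarrow> real ^ 'n \<Rightarrow> ennreal" where
  "cube_avg \<rho> F z = ennreal (1 / (2 * \<rho>) ^ CARD('n)) * (\<integral>\<^sup>+x. F x * indicator (cube z \<rho>) x \<partial>lborel)"

lemma cube_avg_measurable [measurable]:
  assumes [measurable]: "F \<in> borel_measurable borel"
  shows "cube_avg \<rho> F \<in> borel_measurable borel"
  unfolding cube_avg_def[abs_def] by measurable

text \<open>Fubini's theorem and the symmetry of membership. Any integral may thus be replaced by
  the integral of its local averages, which is what makes coverings by cubes dispensable.\<close>

lemma nn_integral_cube_avg:
  fixes F :: "real ^ 'n \<Rightarrow> ennreal"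
  assumes [measurable]: "F \<in> borel_measurable borel" and "0 < \<rho>"
  shows "(\<integral>\<^sup>+z. cube_avg \<rho> F z \<partial>lborel) = (\<integral>\<^sup>+x. F x \<partial>lborel)"
proof -
  have "(\<integral>\<^sup>+z. \<integral>\<^sup>+x. F x * indicator (cube z \<rho>) x \<partial>lborel \<partial>lborel) =
      (\<integral>\<^sup>+x. \<integral>\<^sup>+z. F x * indicator (cube x \<rho>) z \<partial>lborel \<partial>lborel)"
    by (subst lborel_pair.Fubini') (auto simp: indicator_cube_commute)
  also have "\<dots> = ennreal ((2 * \<rho>) ^ CARD('n)) * (\<integral>\<^sup>+x. F x \<partial>lborel)"
    using assms(2) by (simp add: nn_integral_cmult emeasure_cube nn_integral_multc mult.commute)
  finally show ?thesis
    unfolding cube_avg_def using assms(2)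
    by (simp add: nn_integral_cmult mult.assoc[symmetric] ennreal_mult[symmetric])
qed

lemma cube_avg_mono_AE:
  "AE x in lborel. F x \<le> G x \<Longrightarrow> cube_avg \<rho> F z \<le> cube_avg \<rho> G z"
  unfolding cube_avg_def by (intro mult_left_mono nn_integral_mono_AE) (auto simp: mult_right_mono)

lemma cube_avg_add:
  assumes [measurable]: "F \<in> borel_measurable borel" "G \<in> borel_measurable borel"
  shows "cube_avg \<rho> (\<lambda>x. F x + G x) z = cube_avg \<rho> F z + cube_avg \<rho> G z"
  unfolding cube_avg_def by (simp add: distrib_right nn_integral_add distrib_left)

lemma cube_avg_cmult:
  assumes [measurable]: "F \<in> borel_measurable borel"
  shows "cube_avg \<rho> (\<lambda>x. c * F x) z = c * cube_avg \<rho> F z"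
  unfolding cube_avg_def by (simp add: mult.assoc nn_integral_cmult mult.left_commute)

lemma cube_avg_one:
  fixes z :: "real ^ 'n"
  shows "0 < \<rho> \<Longrightarrow> cube_avg \<rho> (\<lambda>_. 1) z = 1"
  unfolding cube_avg_def by (simp add: emeasure_cube ennreal_mult[symmetric])

lemma cube_avg_le_nn_integral:
  fixes z :: "real ^ 'n"
  shows "cube_avg \<rho> F z \<le> ennreal (1 / (2 * \<rho>) ^ CARD('n)) * (\<integral>\<^sup>+x. F x \<partial>lborel)"
  unfolding cube_avg_def
  by (intro mult_left_mono nn_integral_mono) (auto simp: indicator_def)

text \<open>The doubled cube around w contains the cube around z, and 2 ^ n is the ratio of their
  volumes. It moves averages with different centres to one common cube.\<close>

lemma cube_avg_le_double:
  fixes z :: "real ^ 'n"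
  assumes "z \<in> cube w \<rho>" "0 < \<rho>"
  shows "cube_avg \<rho> F z \<le> ennreal (2 ^ CARD('n)) * cube_avg (2 * \<rho>) F w"
proof -
  have "(\<integral>\<^sup>+x. F x * indicator (cube z \<rho>) x \<partial>lborel) \<le> (\<integral>\<^sup>+x. F x * indicator (cube w (2 * \<rho>)) x \<partial>lborel)"
    using cube_subset_cube_double[OF assms(1)]
    by (intro nn_integral_mono mult_left_mono) (auto simp: indicator_def)
  moreover have "ennreal (1 / (2 * \<rho>) ^ CARD('n)) =
      ennreal (2 ^ CARD('n)) * ennreal (1 / (2 * (2 * \<rho>)) ^ CARD('n))"
    using assms(2) by (subst ennreal_mult[symmetric], simp, simp, simp only: power_mult_distrib, simp)
  ultimately show ?thesis
    unfolding cube_avg_def by (simp add: mult.assoc mult_left_mono)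
qed

lemma cube_avg_mult_epowr_le:
  assumes "0 < a" "0 < b" "a + b = 1" "0 < \<rho>"
    and [measurable]: "F \<in> borel_measurable borel" "G \<in> borel_measurable borel"
  shows "cube_avg \<rho> (\<lambda>x. F x epowr a * G x epowr b) z \<le> cube_avg \<rho> F z epowr a * cube_avg \<rho> G z epowr b"
proof -
  define c where "c = ennreal (1 / (2 * \<rho>) ^ CARD('a))"
  \<comment> \<open>The normalising factor distributes over the two averages because the exponents
    add up to 1.\<close>
  have c: "c = c epowr a * c epowr b"
    using assms(3) by (simp add: epowr_add)
  have "(\<integral>\<^sup>+x. (F x epowr a * G x epowr b) * indicator (cube z \<rho>) x \<partial>lborel) =
    (\<integral>\<^sup>+x. (F x * indicator (cube z \<rho>) x) epowr a * (G x * indicator (cube z \<rho>) x) epowr b \<partial>lborel)"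
    by (intro nn_integral_cong) (auto simp: indicator_def)
  also have "\<dots> \<le> (\<integral>\<^sup>+x. F x * indicator (cube z \<rho>) x \<partial>lborel) epowr a *
      (\<integral>\<^sup>+x. G x * indicator (cube z \<rho>) x \<partial>lborel) epowr b"
    using assms by (intro nn_integral_mult_epowr_le) auto
  finally have "cube_avg \<rho> (\<lambda>x. F x epowr a * G x epowr b) z \<le>
    (c epowr a * c epowr b) * ((\<integral>\<^sup>+x. F x * indicator (cube z \<rho>) x \<partial>lborel) epowr a *
      (\<integral>\<^sup>+x. G x * indicator (cube z \<rho>) x \<partial>lborel) epowr b)"
    unfolding cube_avg_def c_def[symmetric] c[symmetric] by (intro mult_left_mono) auto
  then show ?thesis
    unfolding cube_avg_def c_def[symmetric] by (simp add: epowr_mult ac_simps)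
qed

text \<open>Jensen's inequality, as Hoelder's inequality against the constant 1. The case \<kappa> =
  1 is separate because the exponent 1 - 1 / \<kappa> of the constant has to be positive.\<close>

lemma cube_avg_epowr_le:
  assumes "1 \<le> \<kappa>" "0 < \<rho>" and [measurable]: "F \<in> borel_measurable borel"
  shows "cube_avg \<rho> F z epowr \<kappa> \<le> cube_avg \<rho> (\<lambda>x. F x epowr \<kappa>) z"
proof (cases "\<kappa> = 1")
  case False
  then have "cube_avg \<rho> (\<lambda>x. (F x epowr \<kappa>) epowr (1 / \<kappa>) * 1 epowr (1 - 1 / \<kappa>)) z
    \<le> cube_avg \<rho> (\<lambda>x. F x epowr \<kappa>) z epowr (1 / \<kappa>) * cube_avg \<rho> (\<lambda>_. 1) z epowr (1 - 1 / \<kappa>)"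
    using assms by (intro cube_avg_mult_epowr_le) auto
  then show ?thesis
    using assms by (simp add: epowr_le_iff_le_epowr epowr_epowr cube_avg_one)
qed simp

subsection \<open>Summing averages over all dyadic scales\<close>

text \<open>Geometric sums in the form needed for the splitting below: a height that varies
  geometrically with the scale is raised to a power and compared with the same power of a fixed
  value h.\<close>

lemma nn_integral_geometric_powr:
  assumes "\<gamma> \<noteq> 0" "\<theta> \<noteq> 0" "0 < c" "0 < h"
  shows "(\<integral>\<^sup>+j. ennreal ((c * 2 powr (\<gamma> * of_int j)) powr \<theta>) *
      indicator {j. (c * 2 powr (\<gamma> * of_int j)) powr \<theta> \<le> h powr \<theta>} j
      \<partial>count_space (UNIV :: int set)) \<le> ennreal (h powr \<theta> / (1 - 2 powr - \<bar>\<gamma> * \<theta>\<bar>))"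
proof -
  have eq: "(c * 2 powr (\<gamma> * of_int j)) powr \<theta> = c powr \<theta> * 2 powr ((\<gamma> * \<theta>) * of_int j)" for j :: int
    using assms by (simp add: powr_mult powr_powr mult.commute mult.left_commute)
  show ?thesis
    unfolding eq using assms by (intro nn_integral_geometric) auto
qed

text \<open>The averages are split at the height that the norm of \<open>H\<close> allows at each scale, as in the proof
  of the Marcinkiewicz theorem; the strict inequalities between the exponents make both resulting
  sums geometric.\<close>

lemma nn_integral_sum_cube_avg_le:
  fixes H :: "real ^ 'n \<Rightarrow> ennreal"
  assumes "1 < \<sigma>" "\<sigma> < \<kappa>" and H [measurable]: "H \<in> borel_measurable borel"
  shows "(\<integral>\<^sup>+j. \<integral>\<^sup>+z. ennreal (((2 * (2 * 2 powr of_int j)) ^ CARD('n)) powr (\<kappa> / \<sigma> - 1)) *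
        cube_avg (2 * 2 powr of_int j) H z epowr \<kappa> \<partial>lborel \<partial>count_space (UNIV :: int set))
    \<le> ennreal (2 powr \<kappa> * (1 / (1 - 2 powr - \<bar>(- real CARD('n) / \<sigma>) * (\<sigma> - 1)\<bar>) +
        1 / (1 - 2 powr - \<bar>(- real CARD('n) / \<sigma>) * (\<sigma> - \<kappa>)\<bar>))) *
      (\<integral>\<^sup>+x. H x epowr \<sigma> \<partial>lborel) epowr (\<kappa> / \<sigma>)"
    (is "?L \<le> ennreal ?C * _")
proof -
  let ?N = "\<integral>\<^sup>+x. H x epowr \<sigma> \<partial>lborel"
  let ?\<gamma> = "- real CARD('n) / \<sigma>"
  define K1 where "K1 = 1 / (1 - 2 powr - \<bar>?\<gamma> * (\<sigma> - 1)\<bar>)"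
  define K2 where "K2 = 1 / (1 - 2 powr - \<bar>?\<gamma> * (\<sigma> - \<kappa>)\<bar>)"
  have K: "0 < K1" "0 < K2"
    using assms unfolding K1_def K2_def by (auto intro!: divide_pos_pos mult_pos_pos powr_less_one)
  define V :: "int \<Rightarrow> real" where "V j = (2 * (2 * 2 powr of_int j)) ^ CARD('n)" for j
  define A where "A j = cube_avg (2 * 2 powr of_int j) H" for j :: int
  have V: "0 < V j" for j
    by (simp add: V_def)
  have Vpowr: "V j = 4 ^ CARD('n) * 2 powr (real CARD('n) * of_int j)" for j
    by (simp add: V_def power_mult_distrib powr_power)
  consider "?N = top" | "?N = 0" | "?N \<noteq> 0" "?N \<noteq> top"
    by blast
  then show ?thesis
  proof cases
    case 1
    then show ?thesis
    proof -
      have "ennreal ?C \<noteq> 0"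
        using K unfolding K1_def[symmetric] K2_def[symmetric] by simp
      then show ?thesis
        by (simp only: 1 top_epowr ennreal_mult_top if_False top_greatest)
    qed
  next
    case 2
    then have "AE x in lborel. H x epowr \<sigma> = 0"
      by (subst (asm) nn_integral_0_iff_AE) auto
    then have "cube_avg \<rho> H z \<le> cube_avg \<rho> (\<lambda>_. 0) z" for \<rho> z
      by (intro cube_avg_mono_AE) auto
    then have "cube_avg \<rho> H z = 0" for \<rho> z
      by (simp add: cube_avg_def[of _ "\<lambda>_. 0"])
    then show ?thesis
      by (simp only: zero_epowr mult_zero_right nn_integral_const mult_zero_left zero_le)
  next
    case 3
    then obtain N0 where N0: "?N = ennreal N0" "0 < N0"
      by (cases ?N rule: ennreal_cases) (auto simp: less_le)
    define n0 where "n0 = N0 powr (1 / \<sigma>)"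
    have n0: "0 < n0" "n0 powr \<sigma> = N0"
      using N0 assms by (auto simp: n0_def powr_powr)
    \<comment> \<open>The height with \<open>l j powr \<sigma> * V j\<close> equal to
      \<open>N0\<close>. Above it, H is at most \<open>l j powr (1 - \<sigma>)\<close> times its
      power \<sigma>, so the average of \<open>H1 j\<close> over a cube of volume \<open>V j\<close>
      is at most \<open>l j\<close>, whatever the cube.\<close>
    define l where "l j = (n0 * 4 powr ?\<gamma>) * 2 powr (?\<gamma> * of_int j)" for j :: int
    have l: "0 < l j" for j
      using n0 by (simp add: l_def)
    have l_V: "l j powr \<sigma> = n0 powr \<sigma> / V j" for j
    proof -
      have "l j powr \<sigma> = n0 powr \<sigma> * (4 powr (- real CARD('n)) * 2 powr (- real CARD('n) * of_int j))"
        using n0 assms by (simp add: l_def powr_mult powr_powr)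
      also have "\<dots> = n0 powr \<sigma> / V j"
        by (simp add: Vpowr powr_minus divide_inverse powr_realpow)
      finally show ?thesis .
    qed
    have V_l: "V j = (n0 / l j) powr \<sigma>" for j
      using l_V[of j] l[of j] n0(1) V[of j] by (simp add: powr_divide field_simps)
    define H1 where "H1 j x = H x * indicator {x. ennreal (l j) < H x} x" for j x
    define H2 where "H2 j x = H x * indicator {x. H x \<le> ennreal (l j)} x" for j x
    have [measurable]: "H1 j \<in> borel_measurable borel" "H2 j \<in> borel_measurable borel" for j
      unfolding H1_def[abs_def] H2_def[abs_def] by measurable
    have H12: "H x = H1 j x + H2 j x" for j x
      by (auto simp: H1_def H2_def indicator_def not_less)
    have H1_le: "H1 j x \<le> ennreal (l j powr (1 - \<sigma>)) * H x epowr \<sigma>" for j x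
    proof (cases "H x" rule: ennreal_cases)
      case (real h)
      show ?thesis
      proof (cases "l j < h")
        case True
        then have "h \<le> l j powr (1 - \<sigma>) * h powr \<sigma>"
          using l[of j] assms powr_mono2[of "\<sigma> - 1" "l j" h]
          by (simp add: powr_diff field_simps)
        then show ?thesis
          using True real l[of j] by (simp add: H1_def indicator_def ennreal_epowr flip: ennreal_mult)
      qed (use real l[of j] in \<open>auto simp: H1_def indicator_def ennreal_less_iff\<close>)
    qed (use l[of j] in \<open>simp add: ennreal_mult_top\<close>)
    have avg1: "cube_avg (2 * 2 powr of_int j) (H1 j) z \<le> ennreal (l j)" for j z
    proof -
      have "cube_avg (2 * 2 powr of_int j) (H1 j) z \<le> ennreal (1 / V j) * (\<integral>\<^sup>+x. H1 j x \<partial>lborel)"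
        unfolding V_def by (rule cube_avg_le_nn_integral)
      also have "(\<integral>\<^sup>+x. H1 j x \<partial>lborel) \<le> (\<integral>\<^sup>+x. ennreal (l j powr (1 - \<sigma>)) * H x epowr \<sigma> \<partial>lborel)"
        by (intro nn_integral_mono H1_le)
      also have "\<dots> = ennreal (l j powr (1 - \<sigma>)) * ennreal N0"
        by (simp add: nn_integral_cmult N0)
      also have "ennreal (1 / V j) * \<dots> = ennreal (l j powr (1 - \<sigma>) * l j powr \<sigma>)"
        using V[of j] N0 n0 by (simp add: l_V flip: ennreal_mult)
      also have "l j powr (1 - \<sigma>) * l j powr \<sigma> = l j"
        using l[of j] by (simp flip: powr_add)
      finally show ?thesis
        by (simp add: mult_left_mono)
    qed
    \<comment> \<open>Both parts become averages again, whose integrals in z are explicit: of the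
      \<kappa> powers of the average of \<open>H1 j\<close> all but one are replaced by
      \<open>l j\<close>, and Jensen's inequality moves the power inside the average of
      \<open>H2 j\<close>.\<close>
    have A_le: "A j z epowr \<kappa> \<le> ennreal (2 powr \<kappa>) *
        (ennreal (l j powr (\<kappa> - 1)) * cube_avg (2 * 2 powr of_int j) (H1 j) z +
         cube_avg (2 * 2 powr of_int j) (\<lambda>x. H2 j x epowr \<kappa>) z)" for j z
    proof -
      let ?\<rho> = "2 * 2 powr of_int j :: real"
      have "A j z = cube_avg ?\<rho> (H1 j) z + cube_avg ?\<rho> (H2 j) z"
        unfolding A_def by (subst cube_avg_add[symmetric]) (auto simp: H12[symmetric])
      then have "A j z epowr \<kappa> \<le> ennreal (2 powr \<kappa>) *
          (cube_avg ?\<rho> (H1 j) z epowr \<kappa> + cube_avg ?\<rho> (H2 j) z epowr \<kappa>)"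
        using assms by (simp add: add_epowr_le)
      moreover have "cube_avg ?\<rho> (H1 j) z epowr \<kappa> \<le> ennreal (l j powr (\<kappa> - 1)) * cube_avg ?\<rho> (H1 j) z"
      proof -
        have "cube_avg ?\<rho> (H1 j) z epowr \<kappa> =
            cube_avg ?\<rho> (H1 j) z epowr (\<kappa> - 1) * cube_avg ?\<rho> (H1 j) z epowr 1"
          by (simp only: epowr_add) simp
        also have "\<dots> \<le> ennreal (l j) epowr (\<kappa> - 1) * cube_avg ?\<rho> (H1 j) z"
          unfolding epowr_one using assms avg1[of j z] by (intro mult_right_mono epowr_mono) auto
        finally show ?thesis
          using l[of j] by (simp add: ennreal_epowr)
      qed
      moreover have "cube_avg ?\<rho> (H2 j) z epowr \<kappa> \<le> cube_avg ?\<rho> (\<lambda>x. H2 j x epowr \<kappa>) z"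
        using assms by (intro cube_avg_epowr_le) auto
      ultimately show ?thesis
        by (meson add_mono mult_left_mono order_trans zero_le)
    qed
    have V_powr: "V j powr (\<kappa> / \<sigma> - 1) = n0 powr (\<kappa> - \<sigma>) * l j powr (\<sigma> - \<kappa>)" for j
    proof -
      have "V j powr (\<kappa> / \<sigma> - 1) = (n0 / l j) powr (\<sigma> * (\<kappa> / \<sigma> - 1))"
        unfolding V_l by (simp add: powr_powr)
      also have "\<sigma> * (\<kappa> / \<sigma> - 1) = \<kappa> - \<sigma>"
        using assms by (simp add: field_simps)
      also have "(n0 / l j) powr (\<kappa> - \<sigma>) = n0 powr (\<kappa> - \<sigma>) * l j powr (\<sigma> - \<kappa>)"
        using n0 l[of j] powr_minus_divide[of "l j" "\<kappa> - \<sigma>"] by (simp add: powr_divide)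
      finally show ?thesis .
    qed
    define c where "c = ennreal (n0 powr (\<kappa> - \<sigma>) * 2 powr \<kappa>)"
    have "(\<integral>\<^sup>+z. ennreal (V j powr (\<kappa> / \<sigma> - 1)) * A j z epowr \<kappa> \<partial>lborel)
      \<le> c * (\<integral>\<^sup>+x. ennreal (l j powr (\<sigma> - 1)) * H1 j x + ennreal (l j powr (\<sigma> - \<kappa>)) * H2 j x epowr \<kappa> \<partial>lborel)" for j
    proof -
      let ?\<rho> = "2 * 2 powr of_int j :: real"
      have "(\<integral>\<^sup>+z. ennreal (V j powr (\<kappa> / \<sigma> - 1)) * A j z epowr \<kappa> \<partial>lborel)
        \<le> (\<integral>\<^sup>+z. ennreal (V j powr (\<kappa> / \<sigma> - 1)) * (ennreal (2 powr \<kappa>) *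
        (ennreal (l j powr (\<kappa> - 1)) * cube_avg ?\<rho> (H1 j) z + cube_avg ?\<rho> (\<lambda>x. H2 j x epowr \<kappa>) z)) \<partial>lborel)"
        by (intro nn_integral_mono mult_left_mono A_le) auto
      also have "\<dots> = ennreal (V j powr (\<kappa> / \<sigma> - 1)) * (ennreal (2 powr \<kappa>) *
        (ennreal (l j powr (\<kappa> - 1)) * (\<integral>\<^sup>+x. H1 j x \<partial>lborel) + (\<integral>\<^sup>+x. H2 j x epowr \<kappa> \<partial>lborel)))"
        by (simp add: nn_integral_cmult nn_integral_add nn_integral_cube_avg)
      also have "\<dots> = c * (ennreal (l j powr (\<sigma> - \<kappa>)) *
        (ennreal (l j powr (\<kappa> - 1)) * (\<integral>\<^sup>+x. H1 j x \<partial>lborel) + (\<integral>\<^sup>+x. H2 j x epowr \<kappa> \<partial>lborel)))"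
        unfolding V_powr c_def by (simp add: ennreal_mult ac_simps)
      also have "\<dots> = c * (ennreal (l j powr (\<sigma> - 1)) * (\<integral>\<^sup>+x. H1 j x \<partial>lborel) +
          ennreal (l j powr (\<sigma> - \<kappa>)) * (\<integral>\<^sup>+x. H2 j x epowr \<kappa> \<partial>lborel))"
        using l[of j] by (simp add: distrib_left mult.assoc[symmetric] flip: ennreal_mult powr_add)
      also have "\<dots> = c * (\<integral>\<^sup>+x. ennreal (l j powr (\<sigma> - 1)) * H1 j x + ennreal (l j powr (\<sigma> - \<kappa>)) * H2 j x epowr \<kappa> \<partial>lborel)"
        by (simp add: nn_integral_cmult nn_integral_add)
      finally show ?thesis .
    qed
    then have "?L \<le> (\<integral>\<^sup>+j. c * (\<integral>\<^sup>+x. ennreal (l j powr (\<sigma> - 1)) * H1 j x +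
        ennreal (l j powr (\<sigma> - \<kappa>)) * H2 j x epowr \<kappa> \<partial>lborel) \<partial>count_space (UNIV :: int set))"
      unfolding V_def A_def by (intro nn_integral_mono) auto
    also have "\<dots> = c * (\<integral>\<^sup>+x. \<integral>\<^sup>+j. ennreal (l j powr (\<sigma> - 1)) * H1 j x +
        ennreal (l j powr (\<sigma> - \<kappa>)) * H2 j x epowr \<kappa> \<partial>count_space (UNIV :: int set) \<partial>lborel)"
      by (subst nn_integral_count_space_nn_integral) (auto simp: nn_integral_cmult)
    \<comment> \<open>After Tonelli's theorem the scales are summed at a fixed x. With h the value
      of H there, scales with l j < h give h times a sum of \<open>l j powr (\<sigma> - 1)\<close>,
      the others h powr \<kappa> times a sum of \<open>l j powr (\<sigma> - \<kappa>)\<close>. Each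
      sum is geometric and controlled by its size at height h, so both contributions are multiples
      of h powr \<sigma>. Here \<sigma> > 1 and \<sigma> < \<kappa> keep the ratios away from
      1.\<close>
    also have "\<dots> \<le> c * (\<integral>\<^sup>+x. ennreal (K1 + K2) * H x epowr \<sigma> \<partial>lborel)"
    proof (intro mult_left_mono nn_integral_mono)
      fix x
      show "(\<integral>\<^sup>+j. ennreal (l j powr (\<sigma> - 1)) * H1 j x +
        ennreal (l j powr (\<sigma> - \<kappa>)) * H2 j x epowr \<kappa> \<partial>count_space (UNIV :: int set))
        \<le> ennreal (K1 + K2) * H x epowr \<sigma>"
      proof (cases "H x = 0 \<or> H x = top")
        case True
        then show ?thesis
          using K by (auto simp: H1_def H2_def ennreal_mult_top)
      next
        case False
        then obtain h where h: "H x = ennreal h" "0 < h"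
          by (cases "H x" rule: ennreal_cases) (auto simp: less_le)
        have 1: "ennreal (l j powr (\<sigma> - 1)) * H1 j x \<le>
          ennreal h * (ennreal (l j powr (\<sigma> - 1)) * indicator {j. l j powr (\<sigma> - 1) \<le> h powr (\<sigma> - 1)} j)" for j
          using h l[of j] assms powr_mono2[of "\<sigma> - 1" "l j" h]
          by (auto simp: H1_def indicator_def ac_simps ennreal_less_iff)
        have 2: "ennreal (l j powr (\<sigma> - \<kappa>)) * H2 j x epowr \<kappa> \<le>
          ennreal (h powr \<kappa>) * (ennreal (l j powr (\<sigma> - \<kappa>)) * indicator {j. l j powr (\<sigma> - \<kappa>) \<le> h powr (\<sigma> - \<kappa>)} j)" for j
          using h l[of j] assms powr_mono2'[of "\<sigma> - \<kappa>" h "l j"]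
          by (auto simp: H2_def indicator_def ac_simps ennreal_epowr)
        have "(\<integral>\<^sup>+j. ennreal (l j powr (\<sigma> - 1)) * H1 j x +
            ennreal (l j powr (\<sigma> - \<kappa>)) * H2 j x epowr \<kappa> \<partial>count_space (UNIV :: int set))
          \<le> ennreal h * (\<integral>\<^sup>+j. ennreal (l j powr (\<sigma> - 1)) *
              indicator {j. l j powr (\<sigma> - 1) \<le> h powr (\<sigma> - 1)} j \<partial>count_space UNIV) +
            ennreal (h powr \<kappa>) * (\<integral>\<^sup>+j. ennreal (l j powr (\<sigma> - \<kappa>)) *
              indicator {j. l j powr (\<sigma> - \<kappa>) \<le> h powr (\<sigma> - \<kappa>)} j \<partial>count_space UNIV)"
          by (subst nn_integral_cmult[symmetric], simp, subst nn_integral_cmult[symmetric], simp,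
              subst nn_integral_add[symmetric])
             (auto intro!: nn_integral_mono add_mono 1 2)
        also have "\<dots> \<le> ennreal h * ennreal (h powr (\<sigma> - 1) / (1 - 2 powr - \<bar>?\<gamma> * (\<sigma> - 1)\<bar>)) +
            ennreal (h powr \<kappa>) * ennreal (h powr (\<sigma> - \<kappa>) / (1 - 2 powr - \<bar>?\<gamma> * (\<sigma> - \<kappa>)\<bar>))"
          unfolding l_def using assms n0 h
          by (intro add_mono mult_left_mono nn_integral_geometric_powr) auto
        also have "\<dots> = ennreal (h * (h powr (\<sigma> - 1) * K1)) + ennreal (h powr \<kappa> * (h powr (\<sigma> - \<kappa>) * K2))"
          using h K by (simp add: K1_def K2_def flip: ennreal_mult)
        also have "h * (h powr (\<sigma> - 1) * K1) = K1 * h powr \<sigma>"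
          using h by (simp add: powr_diff)
        also have "h powr \<kappa> * (h powr (\<sigma> - \<kappa>) * K2) = K2 * h powr \<sigma>"
          using h by (simp add: powr_diff)
        also have "ennreal (K1 * h powr \<sigma>) + ennreal (K2 * h powr \<sigma>) = ennreal (K1 + K2) * H x epowr \<sigma>"
          using h K by (simp add: ennreal_epowr distrib_right flip: ennreal_plus ennreal_mult)
        finally show ?thesis .
      qed
    qed auto
    also have "\<dots> = c * (ennreal (K1 + K2) * ennreal N0)"
      by (simp add: nn_integral_cmult N0)
    also have "\<dots> = ennreal (2 powr \<kappa> * (K1 + K2)) * ?N epowr (\<kappa> / \<sigma>)"
    proof -
      have "n0 powr (\<kappa> - \<sigma>) * N0 = N0 powr (\<kappa> / \<sigma>)"
        using n0 N0 assms by (simp add: n0_def powr_powr powr_diff[symmetric] powr_mult_base' diff_divide_distrib)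
          (simp add: powr_diff)
      then have "n0 powr (\<kappa> - \<sigma>) * 2 powr \<kappa> * ((K1 + K2) * N0) = 2 powr \<kappa> * (K1 + K2) * N0 powr (\<kappa> / \<sigma>)"
        by (metis (no_types, opaque_lifting) mult.assoc mult.commute)
      moreover have "c * (ennreal (K1 + K2) * ennreal N0) = ennreal (n0 powr (\<kappa> - \<sigma>) * 2 powr \<kappa> * ((K1 + K2) * N0))"
        using K N0(2) by (simp add: c_def flip: ennreal_mult del: ennreal_plus)
      ultimately show ?thesis
        using K N0(2) by (simp add: N0(1) ennreal_epowr flip: ennreal_mult del: ennreal_plus)
    qed
    finally show ?thesis
      by (simp add: K1_def K2_def)
  qed
qed

subsection \<open>The two-weight estimate for a single function\<close>

lemma cube_avg_mono_cube: "(\<And>x. x \<in> cube z \<rho> \<Longrightarrow> F x \<le> G x) \<Longrightarrow> cube_avg \<rho> F z \<le> cube_avg \<rho> G z"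
  unfolding cube_avg_def
  by (intro mult_left_mono nn_integral_mono) (auto simp: indicator_def)

text \<open>Replacing the cube centred at \<open>x\<close> by the cubes centred at nearby points \<open>z\<close> makes the average of
  the weight appear without any covering argument.\<close>

lemma two_weight_scale_le:
  fixes g G k W :: "real ^ 'n \<Rightarrow> ennreal"
  assumes "1 < P" "P < R" "1 < r" "0 < \<rho>"
    and t': "t' = r * (P / (P - 1))" and t: "t = t' / (t' - 1)"
    and [measurable]: "g \<in> borel_measurable borel" "G \<in> borel_measurable borel"
      "k \<in> borel_measurable borel" "W \<in> borel_measurable borel"
    and le: "AE x in lborel. g x \<le> G x * k x"
    and hyp: "\<And>z \<rho>. 0 < \<rho> \<Longrightarrow> ennreal (((2 * \<rho>) ^ CARD('n)) powr (1 / R + b / real CARD('n) - 1 / P)) *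
        cube_avg \<rho> W z epowr (1 / R) * cube_avg \<rho> (\<lambda>x. k x epowr t') z epowr (1 / t') \<le> ennreal C"
    and "0 < C"
  shows "(\<integral>\<^sup>+x. (ennreal (\<rho> powr b) * cube_avg \<rho> g x) epowr R * W x \<partial>lborel)
    \<le> ennreal ((2 ^ CARD('n) * (C * 4 powr - b)) powr R * 2 ^ CARD('n)) *
      (\<integral>\<^sup>+z. ennreal (((2 * (2 * \<rho>)) ^ CARD('n)) powr (R / P - 1)) *
        cube_avg (2 * \<rho>) (\<lambda>x. G x epowr t) z epowr (R / t) \<partial>lborel)"
proof -
  let ?n = "CARD('n)"
  have "1 < t'"
    using assms(1,3) unfolding t' by (intro less_1_mult) (auto simp: field_simps)
  then have "1 < t"
    by (simp add: t field_simps)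
  have tt': "1 / t + 1 / t' = 1"
    using \<open>1 < t'\<close> by (simp add: t field_simps)
  define V where "V = (2 * (2 * \<rho>)) ^ ?n"
  have V: "0 < V" "V = (4 * \<rho>) powr real ?n"
    using assms(4) by (auto simp: V_def powr_realpow)
  define e where "e = 1 / R + b / real ?n - 1 / P"
  have R: "0 < R"
    using assms by linarith
  have "(\<integral>\<^sup>+x. (ennreal (\<rho> powr b) * cube_avg \<rho> g x) epowr R * W x \<partial>lborel) =
      (\<integral>\<^sup>+z. cube_avg \<rho> (\<lambda>x. (ennreal (\<rho> powr b) * cube_avg \<rho> g x) epowr R * W x) z \<partial>lborel)"
    using assms(4) by (intro nn_integral_cube_avg[symmetric]) auto
  \<comment> \<open>Origin of the constant: 2 ^ n inside the power R from doubling the cube of g, 2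
    ^ n outside it from doubling the cube of W, and 4 powr - b from the side 4 \<rho> of the doubled
    cube.\<close>
  also have "\<dots> \<le> (\<integral>\<^sup>+z. ennreal ((2 ^ ?n * (C * 4 powr - b)) powr R * 2 ^ ?n) *
      (ennreal (V powr (R / P - 1)) * cube_avg (2 * \<rho>) (\<lambda>x. G x epowr t) z epowr (R / t)) \<partial>lborel)"
  proof (rule nn_integral_mono)
    fix z
    define a where "a = cube_avg (2 * \<rho>) (\<lambda>x. G x epowr t) z"
    define w where "w = cube_avg (2 * \<rho>) W z"
    define \<kappa> where "\<kappa> = cube_avg (2 * \<rho>) (\<lambda>x. k x epowr t') z"
    \<comment> \<open>Bounds the factor in front of W uniformly for x in
      \<open>cube z \<rho>\<close>, so it leaves the average and all remaining averages belong to
      the one cube to which the hypothesis is applied.\<close>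
    define A where "A = ennreal (\<rho> powr b) * (ennreal (2 ^ ?n) * cube_avg (2 * \<rho>) g z)"
    have "cube_avg (2 * \<rho>) g z \<le> cube_avg (2 * \<rho>) (\<lambda>x. (G x epowr t) epowr (1 / t) * (k x epowr t') epowr (1 / t')) z"
      using le \<open>1 < t\<close> \<open>1 < t'\<close> by (intro cube_avg_mono_AE) (simp add: epowr_epowr)
    also have "\<dots> \<le> a epowr (1 / t) * \<kappa> epowr (1 / t')"
      unfolding a_def \<kappa>_def using \<open>1 < t\<close> \<open>1 < t'\<close> assms(4) tt'
      by (intro cube_avg_mult_epowr_le) auto
    finally have g: "cube_avg (2 * \<rho>) g z \<le> a epowr (1 / t) * \<kappa> epowr (1 / t')" .
    have z: "z \<in> cube z \<rho>"
      using assms(4) by (simp add: mem_cube)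
    have "cube_avg \<rho> (\<lambda>x. (ennreal (\<rho> powr b) * cube_avg \<rho> g x) epowr R * W x) z \<le>
        cube_avg \<rho> (\<lambda>x. A epowr R * W x) z"
      unfolding A_def using R assms(4)
      by (intro cube_avg_mono_cube mult_right_mono epowr_mono mult_left_mono cube_avg_le_double) auto
    also have "\<dots> = A epowr R * cube_avg \<rho> W z"
      by (rule cube_avg_cmult) simp
    also have "\<dots> \<le> A epowr R * (ennreal (2 ^ ?n) * w)"
      unfolding w_def using assms(4) z by (intro mult_left_mono cube_avg_le_double) auto
    also have "\<dots> = (A * w epowr (1 / R)) epowr R * ennreal (2 ^ ?n)"
      using R by (simp add: epowr_mult epowr_epowr ac_simps)
    also have "A * w epowr (1 / R) \<le> ennreal (2 ^ ?n * (C * 4 powr - b)) *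
        (ennreal (V powr (1 / P - 1 / R)) * a epowr (1 / t))"
    proof -
      have "ennreal (V powr e) * w epowr (1 / R) * \<kappa> epowr (1 / t') \<le> ennreal C"
        unfolding V_def e_def w_def \<kappa>_def using assms(4) by (intro hyp) auto
      then have "ennreal (V powr - e) * (ennreal (V powr e) * w epowr (1 / R) * \<kappa> epowr (1 / t'))
          \<le> ennreal (V powr - e) * ennreal C"
        by (intro mult_left_mono) auto
      also have "ennreal (V powr - e) * (ennreal (V powr e) * w epowr (1 / R) * \<kappa> epowr (1 / t')) =
          ennreal (V powr - e * V powr e) * (w epowr (1 / R) * \<kappa> epowr (1 / t'))"
        by (simp add: ennreal_mult mult.assoc)
      also have "V powr - e * V powr e = 1"
        using V by (simp flip: powr_add)
      finally have w\<kappa>: "w epowr (1 / R) * \<kappa> epowr (1 / t') \<le> ennreal (V powr - e * C)"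
        using assms(13) by (simp add: ennreal_mult)
      have "A * w epowr (1 / R) \<le> ennreal (\<rho> powr b) * (ennreal (2 ^ ?n) * (a epowr (1 / t) * \<kappa> epowr (1 / t'))) * w epowr (1 / R)"
        unfolding A_def by (intro mult_right_mono mult_left_mono g) auto
      also have "\<dots> = ennreal (\<rho> powr b * 2 ^ ?n) * (w epowr (1 / R) * \<kappa> epowr (1 / t')) * a epowr (1 / t)"
        by (simp add: ennreal_mult ac_simps)
      also have "\<dots> \<le> ennreal (\<rho> powr b * 2 ^ ?n) * ennreal (V powr - e * C) * a epowr (1 / t)"
        by (intro mult_right_mono mult_left_mono w\<kappa>) auto
      also have "\<dots> = ennreal (2 ^ ?n * (C * (\<rho> powr b * V powr - e))) * a epowr (1 / t)"
        using assms(13) by (simp add: ac_simps flip: ennreal_mult)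
      \<comment> \<open>V is the volume of a cube of side 4 \<rho>, hence V powr (b / n) is (4
        \<rho>) powr b: the power of \<rho> cancels, which makes the estimate uniform over the
        scales.\<close>
      also have "\<rho> powr b * V powr - e = 4 powr - b * V powr (1 / P - 1 / R)"
      proof -
        have "- e = (1 / P - 1 / R) + (- b / real ?n)"
          by (simp add: e_def)
        then have "V powr - e = V powr (1 / P - 1 / R) * V powr (- b / real ?n)"
          by (simp only: powr_add)
        also have "V powr (- b / real ?n) = 4 powr - b * \<rho> powr - b"
          using V assms(4) by (simp add: powr_powr powr_mult)
        finally show ?thesis
          using assms(4) by (simp add: powr_minus field_simps)
      qed
      also have "ennreal (2 ^ ?n * (C * (4 powr - b * V powr (1 / P - 1 / R)))) * a epowr (1 / t) =
        ennreal (2 ^ ?n * (C * 4 powr - b)) * (ennreal (V powr (1 / P - 1 / R)) * a epowr (1 / t))"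
        using assms(13) by (simp add: ennreal_mult ac_simps)
      finally show ?thesis .
    qed
    also have "(ennreal (2 ^ ?n * (C * 4 powr - b)) *
        (ennreal (V powr (1 / P - 1 / R)) * a epowr (1 / t))) epowr R * ennreal (2 ^ ?n) =
        ennreal ((2 ^ ?n * (C * 4 powr - b)) powr R * 2 ^ ?n) *
        (ennreal (V powr (R / P - 1)) * a epowr (R / t))"
    proof -
      have "(1 / P - 1 / R) * R = R / P - 1"
        using R by (simp add: field_simps)
      then have "ennreal (V powr (1 / P - 1 / R)) epowr R = ennreal (V powr (R / P - 1))"
        by (simp add: ennreal_epowr powr_powr)
      moreover have "ennreal (2 ^ ?n * (C * 4 powr - b)) epowr R = ennreal ((2 ^ ?n * (C * 4 powr - b)) powr R)"
        using assms(13) by (intro ennreal_epowr) auto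
      moreover have "ennreal ((2 ^ ?n * (C * 4 powr - b)) powr R * 2 ^ ?n) =
          ennreal ((2 ^ ?n * (C * 4 powr - b)) powr R) * ennreal (2 ^ ?n)"
        by (intro ennreal_mult) auto
      moreover have "1 / t * R = R / t"
        by simp
      ultimately show ?thesis
        unfolding epowr_mult[of "ennreal (2 ^ ?n * (C * 4 powr - b))"]
          epowr_mult[of "ennreal (V powr (1 / P - 1 / R))"] epowr_epowr
        by (simp only: mult_ac)
    qed
    finally show "cube_avg \<rho> (\<lambda>x. (ennreal (\<rho> powr b) * cube_avg \<rho> g x) epowr R * W x) z \<le>
        ennreal ((2 ^ ?n * (C * 4 powr - b)) powr R * 2 ^ ?n) *
        (ennreal (V powr (R / P - 1)) * cube_avg (2 * \<rho>) (\<lambda>x. G x epowr t) z epowr (R / t))"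
      using R by (simp add: a_def epowr_mono mult_right_mono)
  qed
  also have "\<dots> = ennreal ((2 ^ ?n * (C * 4 powr - b)) powr R * 2 ^ ?n) *
      (\<integral>\<^sup>+z. ennreal (V powr (R / P - 1)) * cube_avg (2 * \<rho>) (\<lambda>x. G x epowr t) z epowr (R / t) \<partial>lborel)"
    by (intro nn_integral_cmult) auto
  finally show ?thesis
    by (simp add: V_def)
qed

text \<open>Because r > 1, the exponent \<open>t'\<close> exceeds the conjugate of P and so t < P.
  The unweighted sum over the scales is then available for the function G to the power t, with
  \<sigma> = P / t > 1 and \<kappa> = R / t > \<sigma>.\<close>

lemma two_weight_sum_le:
  fixes k W :: "real ^ 'n \<Rightarrow> ennreal"
  assumes "1 < P" "P < R" "1 < r"
    and [measurable]: "k \<in> borel_measurable borel" "W \<in> borel_measurable borel"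
    and hyp: "\<And>z \<rho>. 0 < \<rho> \<Longrightarrow> ennreal (((2 * \<rho>) ^ CARD('n)) powr (1 / R + b / real CARD('n) - 1 / P)) *
        cube_avg \<rho> W z epowr (1 / R) *
        cube_avg \<rho> (\<lambda>x. k x epowr (r * (P / (P - 1)))) z epowr (1 / (r * (P / (P - 1)))) \<le> ennreal C"
    and "0 < C"
  shows "\<exists>K::real. \<forall>g G. g \<in> borel_measurable borel \<longrightarrow> G \<in> borel_measurable borel \<longrightarrow>
    (AE x in lborel. g x \<le> G x * k x) \<longrightarrow>
    (\<integral>\<^sup>+x. (\<integral>\<^sup>+j. (ennreal (2 powr (b * of_int j)) * cube_avg (2 powr of_int j) g x) epowr R
        \<partial>count_space (UNIV :: int set)) * W x \<partial>lborel)
      \<le> ennreal K * (\<integral>\<^sup>+x. G x epowr P \<partial>lborel) epowr (R / P)"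
proof -
  define t' where "t' = r * (P / (P - 1))"
  define t where "t = t' / (t' - 1)"
  have "1 < P / (P - 1)"
    using assms(1) by (simp add: field_simps)
  then have "P / (P - 1) < t'" "1 < t'"
    using assms(3) mult_strict_right_mono[of 1 r "P / (P - 1)"] unfolding t'_def by auto
  then have "1 < t" "t < P"
    using assms(1) by (auto simp: t_def field_simps)
  define \<sigma> \<kappa> where "\<sigma> = P / t" and "\<kappa> = R / t"
  have \<sigma>\<kappa>: "1 < \<sigma>" "\<sigma> < \<kappa>" "\<kappa> / \<sigma> = R / P" "t * \<sigma> = P"
    using \<open>1 < t\<close> \<open>t < P\<close> assms(1,2) by (auto simp: \<sigma>_def \<kappa>_def divide_strict_right_mono)
  define K0 where "K0 = (2 ^ CARD('n) * (C * 4 powr - b)) powr R * 2 ^ CARD('n)"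
  define K1 where "K1 = 2 powr \<kappa> * (1 / (1 - 2 powr - \<bar>(- real CARD('n) / \<sigma>) * (\<sigma> - 1)\<bar>) +
        1 / (1 - 2 powr - \<bar>(- real CARD('n) / \<sigma>) * (\<sigma> - \<kappa>)\<bar>))"
  show ?thesis
  proof (intro exI[of _ "K0 * K1"] allI impI)
    fix g G :: "real ^ 'n \<Rightarrow> ennreal"
    assume [measurable]: "g \<in> borel_measurable borel" "G \<in> borel_measurable borel"
      and le: "AE x in lborel. g x \<le> G x * k x"
    have "(\<integral>\<^sup>+x. (\<integral>\<^sup>+j. (ennreal (2 powr (b * of_int j)) * cube_avg (2 powr of_int j) g x) epowr R
        \<partial>count_space (UNIV :: int set)) * W x \<partial>lborel) =
      (\<integral>\<^sup>+j. \<integral>\<^sup>+x. (ennreal ((2 powr of_int j) powr b) * cube_avg (2 powr of_int j) g x) epowr R * W x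
        \<partial>lborel \<partial>count_space (UNIV :: int set))"
      by (subst nn_integral_count_space_nn_integral[symmetric])
         (auto simp: nn_integral_cmult powr_powr mult.commute)
    also have "\<dots> \<le> (\<integral>\<^sup>+j. ennreal K0 *
      (\<integral>\<^sup>+z. ennreal (((2 * (2 * 2 powr of_int j)) ^ CARD('n)) powr (\<kappa> / \<sigma> - 1)) *
        cube_avg (2 * 2 powr of_int j) (\<lambda>x. G x epowr t) z epowr \<kappa> \<partial>lborel) \<partial>count_space (UNIV :: int set))"
      unfolding K0_def \<sigma>\<kappa>(3) unfolding \<kappa>_def
    proof (rule nn_integral_mono)
      fix j :: int
      have "0 < (2 powr of_int j :: real)"
        by simp
      from two_weight_scale_le[OF assms(1-3) this t'_def t_def \<open>g \<in> borel_measurable borel\<close>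
          \<open>G \<in> borel_measurable borel\<close> assms(4,5) le hyp[folded t'_def] assms(7)]
      show "(\<integral>\<^sup>+x. (ennreal ((2 powr of_int j) powr b) * cube_avg (2 powr of_int j) g x) epowr R * W x \<partial>lborel)
        \<le> ennreal ((2 ^ CARD('n) * (C * 4 powr - b)) powr R * 2 ^ CARD('n)) *
          (\<integral>\<^sup>+z. ennreal (((2 * (2 * 2 powr of_int j)) ^ CARD('n)) powr (R / P - 1)) *
            cube_avg (2 * 2 powr of_int j) (\<lambda>x. G x epowr t) z epowr (R / t) \<partial>lborel)" .
    qed
    also have "\<dots> = ennreal K0 * (\<integral>\<^sup>+j.
      (\<integral>\<^sup>+z. ennreal (((2 * (2 * 2 powr of_int j)) ^ CARD('n)) powr (\<kappa> / \<sigma> - 1)) *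
        cube_avg (2 * 2 powr of_int j) (\<lambda>x. G x epowr t) z epowr \<kappa> \<partial>lborel) \<partial>count_space (UNIV :: int set))"
      by (intro nn_integral_cmult) auto
    also have "\<dots> \<le> ennreal K0 * (ennreal K1 * (\<integral>\<^sup>+x. (G x epowr t) epowr \<sigma> \<partial>lborel) epowr (\<kappa> / \<sigma>))"
      unfolding K1_def using \<sigma>\<kappa> by (intro mult_left_mono nn_integral_sum_cube_avg_le) auto
    also have "\<dots> = ennreal (K0 * K1) * (\<integral>\<^sup>+x. G x epowr P \<partial>lborel) epowr (R / P)"
      by (simp add: epowr_epowr \<sigma>\<kappa> K0_def ennreal_mult' mult.assoc)
    finally show "(\<integral>\<^sup>+x. (\<integral>\<^sup>+j. (ennreal (2 powr (b * of_int j)) * cube_avg (2 powr of_int j) g x) epowr R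
        \<partial>count_space (UNIV :: int set)) * W x \<partial>lborel)
      \<le> ennreal (K0 * K1) * (\<integral>\<^sup>+x. G x epowr P \<partial>lborel) epowr (R / P)" .
  qed
qed

subsection \<open>The multilinear two-weight estimate\<close>

lemma ex_positive_lower_bound:
  fixes f :: "'i::finite \<Rightarrow> real"
  assumes "\<And>i. 0 < f i"
  shows "\<exists>\<eta>>0. \<forall>i. \<eta> < f i"
proof -
  have "0 < Min (range f)"
    using assms by (subst Min_gr_iff) auto
  moreover have "Min (range f) / 2 < f i" if "0 < Min (range f)" for i
  proof -
    have "Min (range f) \<le> f i"
      by simp
    with that show ?thesis
      by linarith
  qed
  ultimately show ?thesis
    by (intro exI[of _ "Min (range f) / 2"]) auto
qed

text \<open>\<open>1 / R\<close> is moved to \<open>1 / R \<mp> \<eta>\<close> and the order \<open>a\<close> to \<open>a \<plusminus> n\<eta>\<close>, which leaves the power of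
  \<open>|Q|\<close> in the hypothesis unchanged; there is room for this since \<open>P i < R\<close> and \<open>1 < r i\<close> are strict.\<close>

lemma multilinear_two_weight_le:
  fixes k :: "'m::finite \<Rightarrow> real ^ 'n \<Rightarrow> ennreal" and u :: "real ^ 'n \<Rightarrow> ennreal" and P r C :: "'m \<Rightarrow> real"
  assumes P: "\<And>i. 1 < P i" "\<And>i. P i < R" and r: "\<And>i. 1 < r i" and C: "\<And>i. 0 < C i"
    and s': "0 < s'" and R: "R = real CARD('m) * p / s'"
    and [measurable]: "\<And>i. k i \<in> borel_measurable borel" "u \<in> borel_measurable borel"
    and hyp: "\<And>i z \<rho>. 0 < \<rho> \<Longrightarrow> ennreal (((2 * \<rho>) ^ CARD('n)) powr (1 / R + a / real CARD('n) - 1 / P i)) *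
        cube_avg \<rho> (\<lambda>x. u x epowr r i) z epowr (1 / (r i * R)) *
        cube_avg \<rho> (\<lambda>x. k i x epowr (r i * (P i / (P i - 1)))) z epowr (1 / (r i * (P i / (P i - 1)))) \<le> ennreal (C i)"
  shows "\<exists>K::real. \<forall>g G. (\<forall>i. g i \<in> borel_measurable borel) \<longrightarrow> (\<forall>i. G i \<in> borel_measurable borel) \<longrightarrow>
    (\<forall>i. AE x in lborel. g i x \<le> G i x * k i x) \<longrightarrow>
    (\<integral>\<^sup>+x. (\<integral>\<^sup>+j. (\<Prod>i\<in>UNIV. (ennreal (2 powr (a * of_int j)) * cube_avg (2 powr of_int j) (g i) x) epowr (1 / s'))
        \<partial>count_space (UNIV :: int set)) epowr p * u x \<partial>lborel)
      \<le> ennreal K * (\<Prod>i\<in>UNIV. (\<integral>\<^sup>+x. G i x epowr P i \<partial>lborel) epowr (p / (s' * P i)))"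
proof -
  define n m where "n = real CARD('n)" and "m = real CARD('m)"
  have n: "0 < n" and m: "0 < m"
    by (auto simp: n_def m_def)
  have R0: "0 < R"
    using P[of undefined] by linarith
  then have p: "0 < p"
    using s' m unfolding R m_def[symmetric] by (simp add: zero_less_divide_iff zero_less_mult_iff)
  \<comment> \<open>The first margin keeps the perturbed exponents below \<open>r i * R\<close>, so
    that Jensen's inequality can return to the power \<open>r i\<close> of u. The second keeps them
    above \<open>P i\<close>, as \<open>two_weight_sum_le\<close> requires.\<close>
  have "\<exists>\<eta>>0. \<forall>i. \<eta> < min (1 / R - 1 / (r i * R)) (1 / P i - 1 / R)"
    using P r R0 by (intro ex_positive_lower_bound) (auto simp: frac_less2 order_less_trans[OF zero_less_one])
  then obtain \<eta> where \<eta>: "0 < \<eta>" "\<And>i. \<eta> < 1 / R - 1 / (r i * R)" "\<And>i. \<eta> < 1 / P i - 1 / R"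
    by auto
  define sg :: "bool \<Rightarrow> real" where "sg b = (if b then 1 else - 1)" for b
  define Rb where "Rb b = 1 / (1 / R - sg b * \<eta>)" for b
  define ab where "ab b = a + sg b * n * \<eta>" for b
  define Wb where "Wb b x = u x epowr (Rb b / R)" for b x
  \<comment> \<open>Hoelder exponents for the 2m factors indexed by (i, b). They sum to 1 because 1
    / \<open>Rb True\<close> + 1 / \<open>Rb False\<close> = 2 / R and R = m p / s'. The product of
    \<open>Rb b / R\<close> and \<open>\<theta> b\<close> is 1 / (2m) for both b, so the modified
    weights multiply back to u.\<close>
  define \<theta> where "\<theta> b = p / (2 * s' * Rb b)" for b
  have r0: "0 < 1 / (r i * R)" for i
    using r[of i] R0 by simp
  have Rb_inv: "1 / Rb b = 1 / R - sg b * \<eta>" for b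
    by (simp add: Rb_def)
  have "\<bar>sg b * \<eta>\<bar> = \<eta>" for b
    using \<eta>(1) by (simp add: sg_def)
  then have Rb_inv_less: "1 / (r i * R) < 1 / Rb b" "1 / Rb b < 1 / P i" for i b
    using \<eta>(2)[of i] \<eta>(3)[of i] unfolding Rb_inv by (smt (verit))+
  have Rb0: "0 < Rb b" for b
    using Rb_inv_less(1)[of undefined b] r0[of undefined] by (meson less_trans zero_less_divide_1_iff)
  have Rb_less: "Rb b < r i * R" "P i < Rb b" for i b
  proof -
    have "0 < r i * R"
      using r[of i] R0 by simp
    then show "Rb b < r i * R"
      using Rb_inv_less(1)[of i b] inverse_less_imp_less[of "r i * R" "Rb b"] by (simp add: inverse_eq_divide)
    show "P i < Rb b"
      using Rb_inv_less(2)[of b i] Rb0[of b] inverse_less_imp_less[of "Rb b" "P i"] by (simp add: inverse_eq_divide)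
  qed
  have [measurable]: "Wb b \<in> borel_measurable borel" for b
    unfolding Wb_def[abs_def] by measurable
  \<comment> \<open>Here the bump of u is spent: Jensen's inequality for the power \<kappa> = r R /
    Rb \<ge> 1 replaces the modified weight by u to the power \<open>r i\<close>.\<close>
  have Wb_avg: "cube_avg \<rho> (Wb b) z epowr (1 / Rb b) \<le> cube_avg \<rho> (\<lambda>x. u x epowr r i) z epowr (1 / (r i * R))"
    if "0 < \<rho>" for b \<rho> z i
  proof -
    define \<kappa> where "\<kappa> = r i * R / Rb b"
    have "1 \<le> \<kappa>"
      using Rb_less(1)[of b i] Rb0[of b] by (simp add: \<kappa>_def)
    from cube_avg_epowr_le[OF this that, of "Wb b" z]
    have "cube_avg \<rho> (Wb b) z epowr \<kappa> \<le> cube_avg \<rho> (\<lambda>x. u x epowr r i) z"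
      using Rb0[of b] R0 by (simp add: Wb_def epowr_epowr \<kappa>_def)
    from epowr_mono[OF this less_imp_le[OF r0[of i]]] show ?thesis
      using r[of i] R0 by (simp add: epowr_epowr \<kappa>_def)
  qed
  define Q where "Q i b K \<longleftrightarrow> (\<forall>g G. g \<in> borel_measurable borel \<longrightarrow> G \<in> borel_measurable borel \<longrightarrow>
    (AE x in lborel. g x \<le> G x * k i x) \<longrightarrow>
    (\<integral>\<^sup>+x. (\<integral>\<^sup>+j. (ennreal (2 powr (ab b * of_int j)) * cube_avg (2 powr of_int j) g x) epowr Rb b
        \<partial>count_space (UNIV :: int set)) * Wb b x \<partial>lborel)
      \<le> ennreal K * (\<integral>\<^sup>+x. G x epowr P i \<partial>lborel) epowr (Rb b / P i))" for i b and K :: real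
  have "\<exists>K. Q i b K" for i b
    unfolding Q_def
  proof (rule two_weight_sum_le[OF P(1)[of i] Rb_less(2)[of i b] r[of i]])
    fix z :: "real ^ 'n" and \<rho> :: real
    assume "0 < \<rho>"
    have "1 / Rb b + ab b / n = 1 / R + a / n"
      using n by (simp add: Rb_inv ab_def field_simps)
    then have "ennreal (((2 * \<rho>) ^ CARD('n)) powr (1 / Rb b + ab b / real CARD('n) - 1 / P i)) *
        cube_avg \<rho> (Wb b) z epowr (1 / Rb b) *
        cube_avg \<rho> (\<lambda>x. k i x epowr (r i * (P i / (P i - 1)))) z epowr (1 / (r i * (P i / (P i - 1))))
      \<le> ennreal (((2 * \<rho>) ^ CARD('n)) powr (1 / R + a / real CARD('n) - 1 / P i)) *
        cube_avg \<rho> (\<lambda>x. u x epowr r i) z epowr (1 / (r i * R)) *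
        cube_avg \<rho> (\<lambda>x. k i x epowr (r i * (P i / (P i - 1)))) z epowr (1 / (r i * (P i / (P i - 1))))"
      unfolding n_def using \<open>0 < \<rho>\<close> by (simp only:) (intro mult_right_mono mult_left_mono Wb_avg, auto)
    also have "\<dots> \<le> ennreal (C i)"
      by (rule hyp[OF \<open>0 < \<rho>\<close>])
    finally show "ennreal (((2 * \<rho>) ^ CARD('n)) powr (1 / Rb b + ab b / real CARD('n) - 1 / P i)) *
        cube_avg \<rho> (Wb b) z epowr (1 / Rb b) *
        cube_avg \<rho> (\<lambda>x. k i x epowr (r i * (P i / (P i - 1)))) z epowr (1 / (r i * (P i / (P i - 1))))
      \<le> ennreal (C i)" .
  qed (use C in auto)
  then obtain K' where "\<And>i b. Q i b (K' i b)"
    by metis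
  then have K: "g \<in> borel_measurable borel \<Longrightarrow> G \<in> borel_measurable borel \<Longrightarrow>
    (AE x in lborel. g x \<le> G x * k i x) \<Longrightarrow>
    (\<integral>\<^sup>+x. (\<integral>\<^sup>+j. (ennreal (2 powr (ab b * of_int j)) * cube_avg (2 powr of_int j) g x) epowr Rb b
        \<partial>count_space (UNIV :: int set)) * Wb b x \<partial>lborel)
      \<le> ennreal (K' i b) * (\<integral>\<^sup>+x. G x epowr P i \<partial>lborel) epowr (Rb b / P i)" for i b g G
    unfolding Q_def by blast
  \<comment> \<open>Changing the order a by n \<eta> changes each of the m factors by 2 powr (n
    \<eta> j), and the outer power 1 / s' acts on their product.\<close>
  define \<epsilon> where "\<epsilon> = m * n * \<eta> / s'"
  have \<epsilon>: "0 < \<epsilon>"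
    using m n \<eta> s' by (simp add: \<epsilon>_def)
  define K0 where "K0 = 2 / (1 - 2 powr - \<epsilon>)"
  have K0: "0 < K0"
    using \<epsilon> by (simp add: K0_def powr_less_one)
  \<comment> \<open>The constants \<open>K'\<close> come without a sign. Since
    \<open>ennreal\<close> sends negative numbers to 0, cutting them off at 0 leaves the bounds
    unchanged.\<close>
  define K1 where "K1 = (\<Prod>(i, b)\<in>UNIV. max 0 (K' i b) powr \<theta> b)"
  have \<theta>0: "0 < \<theta> b" for b
    using p s' Rb0[of b] by (simp add: \<theta>_def)
  have \<theta>_sum: "\<theta> True + \<theta> False = p / (s' * R)"
  proof -
    have *: "\<theta> b = p / (2 * s') * (1 / Rb b)" for b
      by (simp add: \<theta>_def)
    have "1 / Rb True + 1 / Rb False = 2 * (1 / R)"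
      unfolding Rb_inv by (simp add: sg_def)
    then have "\<theta> True + \<theta> False = p / (2 * s') * (2 * (1 / R))"
      by (simp only: * distrib_left[symmetric])
    then show ?thesis
      by simp
  qed
  have \<theta>1: "(\<Sum>(i, b)\<in>(UNIV :: ('m \<times> bool) set). \<theta> b) = 1"
  proof -
    have "(\<Sum>(i, b)\<in>(UNIV :: ('m \<times> bool) set). \<theta> b) = m * (\<theta> True + \<theta> False)"
      unfolding UNIV_Times_UNIV[symmetric] sum.cartesian_product[symmetric]
      by (simp add: UNIV_bool m_def add.commute)
    also have "\<dots> = 1"
      unfolding \<theta>_sum R using p s' m by (simp add: m_def)
    finally show ?thesis .
  qed
  have \<theta>W: "(\<Prod>(i, b)\<in>(UNIV :: ('m \<times> bool) set). Wb b x epowr \<theta> b) = u x" for x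
  proof -
    have "(\<Prod>(i, b)\<in>(UNIV :: ('m \<times> bool) set). Wb b x epowr \<theta> b) =
        (\<Prod>(i, b)\<in>(UNIV :: ('m \<times> bool) set). u x epowr (p / (2 * s' * R)))"
    proof (intro prod.cong refl)
      have "Rb b / R * \<theta> b = p / (2 * s' * R)" for b
        using Rb0[of b] by (simp add: \<theta>_def)
      then show "(case ib of (i, b) \<Rightarrow> Wb b x epowr \<theta> b) = (case ib of (i, b) \<Rightarrow> u x epowr (p / (2 * s' * R)))" for ib :: "'m \<times> bool"
        by (cases ib) (simp add: Wb_def epowr_epowr)
    qed
    also have "\<dots> = u x epowr (\<Sum>(i, b)\<in>(UNIV :: ('m \<times> bool) set). p / (2 * s' * R))"
      unfolding case_prod_unfold by (intro epowr_sum) auto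
    also have "(\<Sum>(i, b)\<in>(UNIV :: ('m \<times> bool) set). p / (2 * s' * R)) = 1"
      unfolding UNIV_Times_UNIV[symmetric] sum.cartesian_product[symmetric]
      using p s' m by (simp add: UNIV_bool R m_def)
    finally show ?thesis
      by simp
  qed
  show ?thesis
  proof (intro exI[of _ "K0 powr p * K1"] allI impI)
    fix g G :: "'m \<Rightarrow> real ^ 'n \<Rightarrow> ennreal"
    assume g: "\<forall>i. g i \<in> borel_measurable borel" and G: "\<forall>i. G i \<in> borel_measurable borel"
      and le: "\<forall>i. AE x in lborel. g i x \<le> G i x * k i x"
    have [measurable]: "g i \<in> borel_measurable borel" "G i \<in> borel_measurable borel" for i
      using g G by auto
    define S where "S i b x = (\<integral>\<^sup>+j. (ennreal (2 powr (ab b * of_int j)) * cube_avg (2 powr of_int j) (g i) x) epowr Rb b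
        \<partial>count_space (UNIV :: int set))" for i b x
    have [measurable]: "S i b \<in> borel_measurable borel" for i b
      unfolding S_def[abs_def] by measurable
    define X where "X b x = (\<Prod>i\<in>UNIV. S i b x epowr (1 / (s' * Rb b)))" for b x
    \<comment> \<open>A single term is at most the whole sum \<open>S i b x\<close>. This supplies
      the two bounds, uniform in j, that the pointwise interpolation asks for.\<close>
    have S_ge: "ennreal (2 powr (sg b * \<epsilon> * of_int j)) *
        (\<Prod>i\<in>UNIV. (ennreal (2 powr (a * of_int j)) * cube_avg (2 powr of_int j) (g i) x) epowr (1 / s')) \<le> X b x"
      for b j x
    proof -
      have "ennreal (2 powr (sg b * \<epsilon> * of_int j)) = (\<Prod>i\<in>(UNIV :: 'm set). ennreal (2 powr (sg b * n * \<eta> * of_int j)) epowr (1 / s'))"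
        using s' by (simp add: ennreal_epowr powr_powr ennreal_power powr_power \<epsilon>_def m_def mult_ac)
      moreover have "ennreal (2 powr (sg b * n * \<eta> * of_int j)) * ennreal (2 powr (a * of_int j)) = ennreal (2 powr (ab b * of_int j))"
      proof -
        have "ab b * of_int j = sg b * n * \<eta> * of_int j + a * of_int j"
          by (simp add: ab_def distrib_right)
        then show ?thesis
          by (simp add: powr_add ennreal_mult)
      qed
      ultimately have "ennreal (2 powr (sg b * \<epsilon> * of_int j)) *
        (\<Prod>i\<in>UNIV. (ennreal (2 powr (a * of_int j)) * cube_avg (2 powr of_int j) (g i) x) epowr (1 / s')) =
        (\<Prod>i\<in>UNIV. (ennreal (2 powr (ab b * of_int j)) * cube_avg (2 powr of_int j) (g i) x) epowr (1 / s'))"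
        by (simp only: prod.distrib[symmetric] epowr_mult[symmetric] mult.assoc[symmetric])
      also have "\<dots> \<le> X b x"
        unfolding X_def
      proof (intro prod_mono_ennreal)
        fix i
        have "(ennreal (2 powr (ab b * of_int j)) * cube_avg (2 powr of_int j) (g i) x) epowr Rb b \<le> S i b x"
          unfolding S_def by (rule nn_integral_ge_point) simp
        then have "(ennreal (2 powr (ab b * of_int j)) * cube_avg (2 powr of_int j) (g i) x) \<le> S i b x epowr (1 / Rb b)"
          using Rb0[of b] by (simp add: epowr_le_iff_le_epowr)
        from epowr_mono[OF this, of "1 / s'"] s'
        show "(ennreal (2 powr (ab b * of_int j)) * cube_avg (2 powr of_int j) (g i) x) epowr (1 / s') \<le>
            S i b x epowr (1 / (s' * Rb b))"
          by (simp add: epowr_epowr mult.commute)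
      qed
      finally show ?thesis .
    qed
    have "(\<integral>\<^sup>+j. (\<Prod>i\<in>UNIV. (ennreal (2 powr (a * of_int j)) * cube_avg (2 powr of_int j) (g i) x) epowr (1 / s'))
        \<partial>count_space (UNIV :: int set)) \<le> ennreal K0 * (X True x epowr (1 / 2) * X False x epowr (1 / 2))" for x
      unfolding K0_def using S_ge[of True _ x] S_ge[of False _ x]
      by (intro nn_integral_int_le_geometric_mean \<epsilon>) (auto simp: sg_def)
    note pw = epowr_mono[OF this less_imp_le[OF p]]
    have "(\<integral>\<^sup>+x. (\<integral>\<^sup>+j. (\<Prod>i\<in>UNIV. (ennreal (2 powr (a * of_int j)) * cube_avg (2 powr of_int j) (g i) x) epowr (1 / s'))
        \<partial>count_space (UNIV :: int set)) epowr p * u x \<partial>lborel)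
      \<le> (\<integral>\<^sup>+x. ennreal (K0 powr p) * (\<Prod>(i, b)\<in>UNIV. (S i b x * Wb b x) epowr \<theta> b) \<partial>lborel)"
    proof (rule nn_integral_mono)
      fix x
      have "(X True x epowr (1 / 2) * X False x epowr (1 / 2)) epowr p = (\<Prod>(i, b)\<in>UNIV. S i b x epowr \<theta> b)"
        unfolding UNIV_Times_UNIV[symmetric] prod.cartesian_product[symmetric] X_def
        using s' Rb0 by (simp add: UNIV_bool prod_epowr epowr_epowr epowr_mult \<theta>_def prod.distrib ac_simps)
      then have "(ennreal K0 * (X True x epowr (1 / 2) * X False x epowr (1 / 2))) epowr p * u x =
        ennreal (K0 powr p) * (\<Prod>(i, b)\<in>UNIV. (S i b x * Wb b x) epowr \<theta> b)"
        unfolding epowr_mult[of "ennreal K0"] \<theta>W[of x, symmetric] using K0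
        by (simp add: ennreal_epowr mult.assoc prod.distrib[symmetric] case_prod_unfold epowr_mult)
      with mult_right_mono[OF pw[of x], of "u x"]
      show "(\<integral>\<^sup>+j. (\<Prod>i\<in>UNIV. (ennreal (2 powr (a * of_int j)) * cube_avg (2 powr of_int j) (g i) x) epowr (1 / s'))
        \<partial>count_space (UNIV :: int set)) epowr p * u x \<le>
        ennreal (K0 powr p) * (\<Prod>(i, b)\<in>UNIV. (S i b x * Wb b x) epowr \<theta> b)"
        by simp
    qed
    also have "\<dots> = ennreal (K0 powr p) * (\<integral>\<^sup>+x. (\<Prod>(i, b)\<in>UNIV. (S i b x * Wb b x) epowr \<theta> b) \<partial>lborel)"
      unfolding case_prod_unfold by (intro nn_integral_cmult) auto
    also have "(\<integral>\<^sup>+x. (\<Prod>(i, b)\<in>UNIV. (S i b x * Wb b x) epowr \<theta> b) \<partial>lborel) \<le>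
        (\<Prod>(i, b)\<in>UNIV. (\<integral>\<^sup>+x. S i b x * Wb b x \<partial>lborel) epowr \<theta> b)"
      unfolding case_prod_unfold using \<theta>0 \<theta>1[unfolded case_prod_unfold]
      by (intro nn_integral_prod_epowr_le) auto
    also have "\<dots> \<le> (\<Prod>(i, b)\<in>UNIV. (ennreal (max 0 (K' i b)) * (\<integral>\<^sup>+x. G i x epowr P i \<partial>lborel) epowr (Rb b / P i)) epowr \<theta> b)"
      unfolding case_prod_unfold
    proof (intro prod_mono_ennreal epowr_mono)
      fix ib :: "'m \<times> bool"
      show "(\<integral>\<^sup>+x. S (fst ib) (snd ib) x * Wb (snd ib) x \<partial>lborel) \<le>
        ennreal (max 0 (K' (fst ib) (snd ib))) * (\<integral>\<^sup>+x. G (fst ib) x epowr P (fst ib) \<partial>lborel) epowr (Rb (snd ib) / P (fst ib))"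
      proof -
        have "ennreal (max 0 c) = ennreal c" for c
          by (simp add: max_def ennreal_neg)
        then show ?thesis
          unfolding S_def using le by (simp only:) (intro K, auto)
      qed
    qed (use \<theta>0 less_imp_le in auto)
    also have "\<dots> = (\<Prod>(i, b)\<in>UNIV. ennreal (max 0 (K' i b) powr \<theta> b)) *
        (\<Prod>(i, b)\<in>(UNIV :: ('m \<times> bool) set). (\<integral>\<^sup>+x. G i x epowr P i \<partial>lborel) epowr (p / (2 * s' * P i)))"
    proof -
      have "Rb b / P i * \<theta> b = p / (2 * s' * P i)" for i b
        using Rb0[of b] by (simp add: \<theta>_def)
      then show ?thesis
        by (simp add: case_prod_unfold prod.distrib epowr_mult epowr_epowr ennreal_epowr)
    qed
    also have "(\<Prod>(i, b)\<in>UNIV. ennreal (max 0 (K' i b) powr \<theta> b)) = ennreal K1"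
      unfolding K1_def case_prod_unfold by (intro prod_ennreal) auto
    also have "(\<Prod>(i, b)\<in>(UNIV :: ('m \<times> bool) set). (\<integral>\<^sup>+x. G i x epowr P i \<partial>lborel) epowr (p / (2 * s' * P i))) =
        (\<Prod>i\<in>UNIV. (\<integral>\<^sup>+x. G i x epowr P i \<partial>lborel) epowr (p / (s' * P i)))"
      unfolding UNIV_Times_UNIV[symmetric] prod.cartesian_product[symmetric]
      by (simp add: UNIV_bool epowr_add flip: add_divide_distrib)
    also have "ennreal (K0 powr p) * (ennreal K1 * (\<Prod>i\<in>UNIV. (\<integral>\<^sup>+x. G i x epowr P i \<partial>lborel) epowr (p / (s' * P i)))) =
        ennreal (K0 powr p * K1) * (\<Prod>i\<in>UNIV. (\<integral>\<^sup>+x. G i x epowr P i \<partial>lborel) epowr (p / (s' * P i)))"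
      by (simp add: ennreal_mult' mult.assoc)
    finally show "(\<integral>\<^sup>+x. (\<integral>\<^sup>+j. (\<Prod>i\<in>UNIV. (ennreal (2 powr (a * of_int j)) * cube_avg (2 powr of_int j) (g i) x) epowr (1 / s'))
        \<partial>count_space (UNIV :: int set)) epowr p * u x \<partial>lborel)
      \<le> ennreal (K0 powr p * K1) * (\<Prod>i\<in>UNIV. (\<integral>\<^sup>+x. G i x epowr P i \<partial>lborel) epowr (p / (s' * P i)))"
      by (simp add: mult_left_mono)
  qed
qed

subsection \<open>Lebesgue measure on \<open>(\<real>\<^sup>n)\<^sup>m\<close>\<close>

lemma AE_lborel_affine:
  fixes t :: "'a::euclidean_space"
  assumes "c \<noteq> 0" "AE x in lborel. P x"
  shows "AE x in lborel. P (t + c *\<^sub>R x)"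
proof -
  have "AE x in density (distr lborel borel (\<lambda>x. t + c *\<^sub>R x)) (\<lambda>_. \<bar>c\<bar> ^ DIM('a)). P x"
    using assms(2) unfolding lborel_affine[OF assms(1), of t, symmetric] .
  then have "AE x in distr lborel borel (\<lambda>x. t + c *\<^sub>R x). P x"
    using assms(1) by (subst (asm) AE_density) auto
  then show ?thesis
    by (rule AE_distrD[rotated]) simp
qed

lemma nn_integral_lborel_affine:
  fixes t :: "'a::euclidean_space"
  assumes "c \<noteq> 0" and [measurable]: "f \<in> borel_measurable borel"
  shows "(\<integral>\<^sup>+x. f x \<partial>lborel) = ennreal (\<bar>c\<bar> ^ DIM('a)) * (\<integral>\<^sup>+x. f (t + c *\<^sub>R x) \<partial>lborel)"
  by (subst lborel_affine[OF assms(1), of t])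
     (simp add: nn_integral_density nn_integral_distr nn_integral_cmult)

lemma mem_box_vec:
  fixes l u :: "'a::euclidean_space ^ 'm"
  shows "y \<in> box l u \<longleftrightarrow> (\<forall>i. y $ i \<in> box (l $ i) (u $ i))"
  by (auto simp: mem_box Basis_vec_def inner_axis)

lemma prod_Basis_vec:
  fixes f :: "'a::euclidean_space ^ 'm \<Rightarrow> 'b::comm_monoid_mult"
  shows "(\<Prod>b\<in>Basis. f b) = (\<Prod>i\<in>UNIV. \<Prod>b\<in>Basis. f (axis i b))"
proof -
  have "(\<Prod>i\<in>UNIV. \<Prod>b\<in>Basis. f (axis i b)) = (\<Prod>(i, b)\<in>UNIV \<times> Basis. f (axis i b))"
    by (rule prod.cartesian_product)
  also have "\<dots> = (\<Prod>b\<in>Basis. f b)"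
  proof (rule prod.reindex_cong[symmetric, where l = "\<lambda>(i, b). axis i b"])
    show "inj_on (\<lambda>(i :: 'm, b). axis i b) (UNIV \<times> (Basis :: 'a set))"
      by (auto simp: inj_on_def axis_eq_axis)
    show "Basis = (\<lambda>(i :: 'm, b). axis i b) ` (UNIV \<times> (Basis :: 'a set))"
      by (auto simp: Basis_vec_def image_iff)
  qed auto
  finally show ?thesis ..
qed

lemma measurable_vec_lambda_PiM [measurable]:
  "(\<lambda>f. \<chi> i. f i) \<in> Pi\<^sub>M UNIV (\<lambda>_::'m::finite. lborel :: 'a::euclidean_space measure) \<rightarrow>\<^sub>M borel"
proof (subst borel_measurable_euclidean_space, intro ballI)
  fix b :: "'a ^ 'm" assume "b \<in> Basis"
  then obtain i c where "b = axis i c"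
    by (auto simp: Basis_vec_def)
  moreover have "(\<lambda>f. f i \<bullet> c) \<in> borel_measurable (Pi\<^sub>M UNIV (\<lambda>_::'m. lborel :: 'a measure))"
    by measurable
  ultimately show "(\<lambda>f. (\<chi> i. f i) \<bullet> b) \<in> borel_measurable (Pi\<^sub>M UNIV (\<lambda>_::'m. lborel :: 'a measure))"
    by (simp add: inner_axis)
qed

text \<open>Both measures agree on boxes, which determine Lebesgue measure. This identification
  opens the way to Fubini's theorem over the components.\<close>

lemma lborel_vec_eq:
  "(lborel :: ('a::euclidean_space ^ 'm) measure) = distr (Pi\<^sub>M UNIV (\<lambda>_. lborel)) borel (\<lambda>f. \<chi> i. f i)"
proof (rule lborel_eqI)
  interpret product_sigma_finite "\<lambda>_ :: 'm. lborel :: 'a measure"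
    by standard
  fix l u :: "'a ^ 'm"
  assume le: "\<And>b. b \<in> Basis \<Longrightarrow> l \<bullet> b \<le> u \<bullet> b"
  then have le': "l $ i \<bullet> b \<le> u $ i \<bullet> b" if "b \<in> Basis" for i b
    using le[of "axis i b"] that by (auto simp: inner_axis Basis_vec_def)
  have "(\<lambda>f. \<chi> i. f i) -` box l u \<inter> space (Pi\<^sub>M UNIV (\<lambda>_. lborel)) = (\<Pi>\<^sub>E i\<in>UNIV. box (l $ i) (u $ i))"
    by (auto simp: mem_box_vec space_PiM PiE_UNIV_domain Pi_iff)
  then have "emeasure (distr (Pi\<^sub>M UNIV (\<lambda>_. lborel)) borel (\<lambda>f. \<chi> i. f i)) (box l u) =
      emeasure (Pi\<^sub>M UNIV (\<lambda>_. lborel)) (\<Pi>\<^sub>E i\<in>UNIV. box (l $ i) (u $ i))"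
    by (simp add: emeasure_distr)
  also have "\<dots> = (\<Prod>i\<in>UNIV. emeasure lborel (box (l $ i) (u $ i)))"
    by (intro emeasure_PiM) auto
  also have "\<dots> = (\<Prod>b\<in>Basis. ennreal ((u - l) \<bullet> b))"
    unfolding prod_Basis_vec using le'
    by (intro prod.cong refl) (simp add: prod_ennreal inner_axis inner_diff_left)
  also have "\<dots> = ennreal (\<Prod>b\<in>Basis. (u - l) \<bullet> b)"
    using le by (intro prod_ennreal) (simp add: inner_diff_left)
  finally show "emeasure (distr (Pi\<^sub>M UNIV (\<lambda>_. lborel)) borel (\<lambda>f. \<chi> i. f i)) (box l u) =
      ennreal (\<Prod>b\<in>Basis. (u - l) \<bullet> b)" .
qed simp

lemma borel_measurable_vec_nth [measurable]:
  "(\<lambda>y :: 'a::euclidean_space ^ 'm. y $ i) \<in> borel_measurable borel"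
  by (intro borel_measurable_continuous_onI continuous_intros)

lemma nn_integral_lborel_vec_prod:
  fixes h :: "'m::finite \<Rightarrow> 'a::euclidean_space \<Rightarrow> ennreal"
  assumes [measurable]: "\<And>i. h i \<in> borel_measurable borel"
  shows "(\<integral>\<^sup>+y. (\<Prod>i\<in>UNIV. h i (y $ i)) \<partial>lborel) = (\<Prod>i\<in>UNIV. \<integral>\<^sup>+z. h i z \<partial>lborel)"
proof -
  interpret product_sigma_finite "\<lambda>_ :: 'm. lborel :: 'a measure"
    by standard
  show ?thesis
    unfolding lborel_vec_eq by (subst nn_integral_distr) (auto intro!: product_nn_integral_prod)
qed

lemma nn_integral_lborel_vec_prod_diff:
  fixes h :: "'m::finite \<Rightarrow> 'a::euclidean_space \<Rightarrow> ennreal"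
  assumes [measurable]: "\<And>i. h i \<in> borel_measurable borel"
  shows "(\<integral>\<^sup>+y. (\<Prod>i\<in>UNIV. h i (x - y $ i)) \<partial>lborel) = (\<Prod>i\<in>UNIV. \<integral>\<^sup>+z. h i z \<partial>lborel)"
proof -
  have "(\<integral>\<^sup>+z. h i (x - z) \<partial>lborel) = (\<integral>\<^sup>+z. h i z \<partial>lborel)" for i
    using nn_integral_lborel_affine[of "-1" "h i" x] by simp
  then show ?thesis
    using nn_integral_lborel_vec_prod[of "\<lambda>i z. h i (x - z)"] by simp
qed

text \<open>The cylinder over a null set is null: the product formula for its measure contains a
  factor 0, and \<open>0 * top = 0\<close> absorbs the infinite factors of the other
  components.\<close>

lemma AE_lborel_vec_nth:
  fixes i :: "'m::finite"
  assumes "AE z in lborel. P (z :: 'a::euclidean_space)"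
  shows "AE y in lborel. P (y $ i)"
proof -
  obtain N where N: "N \<in> null_sets lborel" "{z. \<not> P z} \<subseteq> N"
    using assms by (auto simp: eventually_ae_filter)
  then have [measurable]: "N \<in> sets borel"
    by auto
  have "(\<integral>\<^sup>+y. (\<Prod>k\<in>UNIV. (if k = i then indicator N (y $ k) else 1)) \<partial>lborel) =
      (\<Prod>k\<in>(UNIV :: 'm set). \<integral>\<^sup>+z. (if k = i then indicator N z else 1) \<partial>lborel)"
    using nn_integral_lborel_vec_prod[of "\<lambda>k z. if k = i then indicator N z else 1"] by simp
  also have "\<dots> = 0"
    using N(1) by (intro prod_zero bexI[of _ i]) auto
  finally have "AE y in lborel. (\<Prod>k\<in>UNIV. (if k = i then indicator N (y $ k) else 1)) = (0 :: ennreal)"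
    by (subst (asm) nn_integral_0_iff_AE) auto
  then show ?thesis
  proof eventually_elim
    case (elim y)
    then have "y $ i \<notin> N"
      by (auto simp: indicator_def split: if_splits)
    then show ?case
      using N(2) by auto
  qed
qed

lemma AE_lborel_diff_vec_nth:
  fixes i :: "'m::finite"
  assumes "AE z in lborel. P (z :: 'a::euclidean_space)"
  shows "AE y in lborel. P (x - y $ i)"
  using AE_lborel_vec_nth[of "\<lambda>z. P (x - z)" i] AE_lborel_affine[of "-1" P x] assms by simp

subsection \<open>Homogeneous functions in \<open>L\<^sup>s\<close> of the sphere\<close>

lemma completion_ex_borel_measurable_complex:
  fixes g :: "'a \<Rightarrow> complex"
  assumes [measurable]: "g \<in> borel_measurable (completion M)"
  shows "\<exists>g'\<in>borel_measurable M. AE x in M. g x = g' x"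
proof -
  have "(\<lambda>x. Re (g x)) \<in> borel_measurable (completion M)" "(\<lambda>x. Im (g x)) \<in> borel_measurable (completion M)"
    by measurable
  from this[THEN completion_ex_borel_measurable_real]
  obtain a b where [measurable]: "a \<in> borel_measurable M" "b \<in> borel_measurable M"
    and "AE x in M. Re (g x) = a x" "AE x in M. Im (g x) = b x"
    by auto
  then have "AE x in M. g x = Complex (a x) (b x)"
    by (auto simp: complex_eq_iff)
  moreover have "(\<lambda>x. Complex (a x) (b x)) \<in> borel_measurable M"
    unfolding borel_measurable_complex_iff by simp
  ultimately show ?thesis
    by (rule bexI)
qed

lemma homogeneous_eq_sgn:
  fixes \<Omega> :: "'a::real_normed_vector \<Rightarrow> 'b"
  assumes "homogeneous_deg_zero \<Omega>" "y \<noteq> 0"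
  shows "\<Omega> (sgn y) = \<Omega> y"
proof -
  have "inverse (norm y) > 0"
    using assms(2) by simp
  then show ?thesis
    using assms unfolding homogeneous_deg_zero_def sgn_div_norm by blast
qed

text \<open>The sphere measure before completion. A function measurable for the completion agrees
  almost everywhere with one measurable here, and only the latter can be composed with
  \<open>sgn\<close> to a Borel function.\<close>

definition presphere_measure :: "'a::euclidean_space measure" where
  "presphere_measure = scale_measure (ennreal (real DIM('a)))
     (distr (restrict_space lebesgue (ball 0 1 - {0})) (restrict_space borel (sphere 0 1)) sgn)"

lemma sphere_measure_eq: "sphere_measure = completion presphere_measure"
  by (simp add: sphere_measure_def presphere_measure_def)

lemma sets_presphere_measure [measurable_cong]:
  "sets (presphere_measure :: 'a::euclidean_space measure) = sets (restrict_space borel (sphere 0 1))"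
  by (simp add: presphere_measure_def)

lemma measurable_sgn_ball:
  "sgn \<in> restrict_space lebesgue (ball 0 1 - {0 :: 'a::euclidean_space}) \<rightarrow>\<^sub>M restrict_space borel (sphere 0 1)"
proof -
  have "(\<lambda>x::'a. sgn x) \<in> borel_measurable lborel"
    unfolding sgn_div_norm by measurable
  then have "sgn \<in> borel_measurable (lebesgue :: 'a measure)"
    by (simp add: measurable_completion)
  then show ?thesis
    by (intro measurable_restrict_space2 measurable_restrict_space1) (auto simp: space_restrict_space norm_sgn)
qed

text \<open>By construction, null sets on the sphere pull back to null sets in the punctured unit
  ball. Countably many dilates of that ball exhaust the space without the origin, and
  \<open>sgn\<close> is invariant under positive dilations.\<close>

lemma AE_presphere_measure_imp:
  fixes P :: "'a::euclidean_space \<Rightarrow> bool"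
  assumes "AE x in presphere_measure. P x"
  shows "AE y in lborel. y \<noteq> 0 \<longrightarrow> P (sgn y)"
proof -
  have "AE x in distr (restrict_space lebesgue (ball 0 1 - {0})) (restrict_space borel (sphere 0 1)) sgn. P x"
  proof -
    have "null_sets (scale_measure (ennreal (real DIM('a))) M) = null_sets M" for M :: "'a measure"
      by (auto simp: null_sets_def)
    then show ?thesis
      using assms by (simp add: presphere_measure_def eventually_ae_filter space_scale_measure)
  qed
  from AE_distrD[OF measurable_sgn_ball this]
  have "AE y in lebesgue. y \<in> ball 0 1 - {0} \<longrightarrow> P (sgn y)"
    by (subst (asm) AE_restrict_space_iff) auto
  then have *: "AE y in lborel. y \<in> ball 0 1 - {0 :: 'a} \<longrightarrow> P (sgn y)"
    by (simp add: AE_completion_iff)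
  have "AE y in lborel. (1 / real (Suc k)) *\<^sub>R y \<in> ball 0 1 - {0 :: 'a} \<longrightarrow> P (sgn y)" for k
    using AE_lborel_affine[OF _ *, of "1 / real (Suc k)" 0] by (simp add: sgn_scaleR)
  then have "AE y in lborel. \<forall>k. (1 / real (Suc k)) *\<^sub>R y \<in> ball 0 1 - {0 :: 'a} \<longrightarrow> P (sgn y)"
    by (intro AE_all_countable[THEN iffD2] allI)
  then show ?thesis
  proof eventually_elim
    case (elim y)
    show ?case
    proof
      assume "y \<noteq> 0"
      obtain k where "norm y < real k"
        using reals_Archimedean2 by blast
      then have "(1 / real (Suc k)) *\<^sub>R y \<in> ball 0 1 - {0}"
        using \<open>y \<noteq> 0\<close> by (simp add: divide_less_eq)
      then show "P (sgn y)"
        using elim by blast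
    qed
  qed
qed

lemma nn_integral_presphere_measure:
  fixes f :: "'a::euclidean_space \<Rightarrow> ennreal"
  assumes [measurable]: "f \<in> borel_measurable presphere_measure"
  shows "(\<integral>\<^sup>+x. f x \<partial>presphere_measure) =
    ennreal (real DIM('a)) * (\<integral>\<^sup>+y. f (sgn y) * indicator (ball 0 1 - {0}) y \<partial>lborel)"
proof -
  have f: "f \<in> borel_measurable (restrict_space borel (sphere 0 1))"
    using assms measurable_cong_sets[OF sets_presphere_measure refl] by blast
  show ?thesis
    unfolding presphere_measure_def
    by (subst nn_integral_scale_measure)
       (use f in \<open>auto simp: nn_integral_distr[OF measurable_sgn_ball] nn_integral_restrict_space nn_integral_completion\<close>)
qed

text \<open>Hoelder's inequality on a ball. By homogeneity the integral of the power s over the ball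
  of radius T is T ^ DIM times that over the unit ball, hence the power of T with exponent DIM / s =
  DIM (1 - 1 / s'). The Borel version is constant along every ray, not merely along almost every
  one, which keeps the dilation argument exact.\<close>

lemma homogeneous_Lebesgue_sphere_le:
  fixes \<Omega> :: "'a::euclidean_space \<Rightarrow> complex"
  assumes s: "1 < s" "1 / s + 1 / ennreal s' = 1" "1 \<le> s'"
    and hom: "homogeneous_deg_zero \<Omega>" and \<Omega>: "in_Lebesgue_space s sphere_measure \<Omega>"
  obtains \<Omega>' :: "'a \<Rightarrow> complex" and K :: real
  where "\<Omega>' \<in> borel_measurable borel" "AE y in lborel. \<Omega> y = \<Omega>' y" "0 \<le> K"
    "\<And>T F. 0 < T \<Longrightarrow> F \<in> borel_measurable borel \<Longrightarrow>
      (\<integral>\<^sup>+y. ennreal (norm (\<Omega>' y)) * F y * indicator (ball 0 T) y \<partial>lborel)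
        \<le> ennreal (K * T powr (real DIM('a) * (1 - 1 / s'))) * (\<integral>\<^sup>+y. F y epowr s' \<partial>lborel) epowr (1 / s')"
proof -
  have "\<Omega> \<in> borel_measurable (completion presphere_measure)"
    using \<Omega> by (simp add: in_Lebesgue_space_def sphere_measure_eq)
  from completion_ex_borel_measurable_complex[OF this]
  obtain \<Omega>0 where \<Omega>0 [measurable]: "\<Omega>0 \<in> borel_measurable presphere_measure"
    and AE0: "AE x in presphere_measure. \<Omega> x = \<Omega>0 x"
    by (rule bexE)
  define \<Omega>' where "\<Omega>' y = (if y = 0 then 0 else \<Omega>0 (sgn y))" for y
  have meas: "\<Omega>' \<in> borel_measurable borel"
  proof -
    have "(\<lambda>x::'a. sgn x) \<in> borel_measurable borel"
      unfolding sgn_div_norm by measurable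
    then have "sgn \<in> restrict_space borel (- {0 :: 'a}) \<rightarrow>\<^sub>M restrict_space borel (sphere 0 1)"
      by (intro measurable_restrict_space2 measurable_restrict_space1) (auto simp: space_restrict_space norm_sgn)
    moreover have "\<Omega>0 \<in> borel_measurable (restrict_space borel (sphere 0 1))"
      using \<Omega>0 measurable_cong_sets[OF sets_presphere_measure refl] by blast
    ultimately have "(\<lambda>y. \<Omega>0 (sgn y)) \<in> borel_measurable (restrict_space borel (- {0 :: 'a}))"
      by (rule measurable_compose)
    then show ?thesis
      unfolding \<Omega>'_def[abs_def] by (intro measurable_If_restrict_space_iff[THEN iffD2] conjI)
        (auto simp: Compl_eq)
  qed
  have AE': "AE y in lborel. \<Omega> y = \<Omega>' y"
  proof -
    have "AE y in lborel. y \<noteq> (0 :: 'a)"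
      by (rule AE_lborel_singleton)
    with AE_presphere_measure_imp[OF AE0] show ?thesis
      by eventually_elim (auto simp: \<Omega>'_def homogeneous_eq_sgn[OF hom])
  qed
  have \<Omega>'_scale: "\<Omega>' (c *\<^sub>R y) = \<Omega>' y" if "0 < c" for c y
    using that by (simp add: \<Omega>'_def sgn_scaleR)
  show ?thesis
  proof (cases "s = \<infinity>")
    case True
    \<comment> \<open>In \<open>ennreal\<close>, 1 / \<infinity> is 0, so s' = 1: the power of T
      disappears and the essential bound of the kernel is the constant.\<close>
    then have "1 / ennreal s' = 1"
      using s(2) by simp
    then have "s' = 1"
      using s(3) by (simp add: divide_ennreal flip: ennreal_1)
    obtain B where "AE x in completion presphere_measure. norm (\<Omega> x) \<le> B"
      using \<Omega> True by (auto simp: in_Lebesgue_space_def sphere_measure_eq)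
    then have "AE x in presphere_measure. norm (\<Omega> x) \<le> B"
      by (simp add: AE_completion_iff)
    with AE0 have "AE x in presphere_measure. norm (\<Omega>0 x) \<le> B"
      by eventually_elim auto
    from AE_presphere_measure_imp[OF this] have B: "AE y in lborel. norm (\<Omega>' y) \<le> max 0 B"
      by eventually_elim (auto simp: \<Omega>'_def)
    show ?thesis
    proof (rule that[OF meas AE', of "max 0 B"])
      fix T :: real and F :: "'a \<Rightarrow> ennreal"
      assume [measurable]: "F \<in> borel_measurable borel" and "0 < T"
      have "(\<integral>\<^sup>+y. ennreal (norm (\<Omega>' y)) * F y * indicator (ball 0 T) y \<partial>lborel) \<le>
          (\<integral>\<^sup>+y. ennreal (max 0 B) * F y \<partial>lborel)"
      proof (rule nn_integral_mono_AE)
        show "AE y in lborel. ennreal (norm (\<Omega>' y)) * F y * indicator (ball 0 T) y \<le> ennreal (max 0 B) * F y"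
          using B
        proof eventually_elim
          case (elim y)
          have "ennreal (norm (\<Omega>' y)) * F y * indicator (ball 0 T) y \<le> ennreal (norm (\<Omega>' y)) * F y"
            by (simp add: indicator_def)
          also have "\<dots> \<le> ennreal (max 0 B) * F y"
            by (intro mult_right_mono ennreal_leI elim) simp
          finally show ?case .
        qed
      qed
      then show "(\<integral>\<^sup>+y. ennreal (norm (\<Omega>' y)) * F y * indicator (ball 0 T) y \<partial>lborel) \<le>
        ennreal (max 0 B * T powr (real DIM('a) * (1 - 1 / s'))) * (\<integral>\<^sup>+y. F y epowr s' \<partial>lborel) epowr (1 / s')"
        using \<open>0 < T\<close> by (simp add: \<open>s' = 1\<close> nn_integral_cmult)
    qed simp
  next
    case False
    define t where "t = enn2real s"
    have "s = ennreal t"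
      using False by (simp add: t_def less_top)
    moreover have "1 < t"
      using s(1) unfolding \<open>s = ennreal t\<close> by (metis ennreal_1 ennreal_less_iff zero_le_one)
    ultimately have st: "s = ennreal t" "1 < t"
      by auto
    have "ennreal (1 / t + 1 / s') = ennreal 1"
      using s st by (simp add: divide_ennreal flip: ennreal_1 ennreal_plus)
    then have ts': "1 / t + 1 / s' = 1"
      using st s(3) by (subst (asm) ennreal_inj) auto
    then have s'1: "0 < s'" "1 - 1 / s' = 1 / t"
      using s(3) by auto
    define I where "I = (\<integral>\<^sup>+y. ennreal (norm (\<Omega>' y) powr t) * indicator (ball 0 1) y \<partial>lborel)"
    have "(\<integral>\<^sup>+x. ennreal (norm (\<Omega> x) powr t) \<partial>presphere_measure) < \<infinity>"
      using \<Omega> False by (simp add: in_Lebesgue_space_def sphere_measure_eq nn_integral_completion t_def)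
    also have "(\<integral>\<^sup>+x. ennreal (norm (\<Omega> x) powr t) \<partial>presphere_measure) =
        (\<integral>\<^sup>+x. ennreal (norm (\<Omega>0 x) powr t) \<partial>presphere_measure)"
      using AE0 by (intro nn_integral_cong_AE) auto
    also have "\<dots> = ennreal (real DIM('a)) *
        (\<integral>\<^sup>+y. ennreal (norm (\<Omega>0 (sgn y)) powr t) * indicator (ball 0 1 - {0}) y \<partial>lborel)"
      by (intro nn_integral_presphere_measure) measurable
    also have "(\<integral>\<^sup>+y. ennreal (norm (\<Omega>0 (sgn y)) powr t) * indicator (ball 0 1 - {0}) y \<partial>lborel) = I"
      unfolding I_def using st by (intro nn_integral_cong) (auto simp: \<Omega>'_def indicator_def)
    finally have "I < \<infinity>"
      by (auto simp: ennreal_mult_less_top)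
    then obtain I' where I': "I = ennreal I'" "0 \<le> I'"
      by (cases I rule: ennreal_cases) auto
    show ?thesis
    proof (rule that[OF meas AE', of "I' powr (1 / t)"])
      fix T :: real and F :: "'a \<Rightarrow> ennreal"
      assume [measurable]: "F \<in> borel_measurable borel" and "0 < T"
      have [measurable]: "\<Omega>' \<in> borel_measurable borel" "ball 0 T \<in> sets (borel :: 'a measure)"
        using meas by auto
      \<comment> \<open>Substitution of T y for y; the kernel does not change under the dilation, so
        only the volume factor appears.\<close>
      have I_T: "(\<integral>\<^sup>+y. ennreal (norm (\<Omega>' y) powr t) * indicator (ball 0 T) y \<partial>lborel) = ennreal (T ^ DIM('a)) * I"
      proof -
        have "(\<integral>\<^sup>+y. ennreal (norm (\<Omega>' y) powr t) * indicator (ball 0 T) y \<partial>lborel) = ennreal (T ^ DIM('a)) *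
          (\<integral>\<^sup>+y. ennreal (norm (\<Omega>' (T *\<^sub>R y)) powr t) * indicator (ball 0 T) (T *\<^sub>R y) \<partial>lborel)"
          using \<open>0 < T\<close> by (subst nn_integral_lborel_affine[of T _ 0]) auto
        also have "(\<lambda>y. ennreal (norm (\<Omega>' (T *\<^sub>R y)) powr t) * indicator (ball 0 T) (T *\<^sub>R y)) =
          (\<lambda>y. ennreal (norm (\<Omega>' y) powr t) * indicator (ball 0 1) y)"
          using \<open>0 < T\<close> by (auto simp: fun_eq_iff \<Omega>'_scale indicator_def)
        finally show ?thesis
          by (simp add: I_def)
      qed
      have "(\<integral>\<^sup>+y. ennreal (norm (\<Omega>' y)) * F y * indicator (ball 0 T) y \<partial>lborel) =
        (\<integral>\<^sup>+y. (ennreal (norm (\<Omega>' y) powr t) * indicator (ball 0 T) y) epowr (1 / t) * (F y epowr s') epowr (1 / s') \<partial>lborel)"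
        using st s'1(1) by (intro nn_integral_cong)
          (auto simp: indicator_def ennreal_epowr powr_powr epowr_epowr)
      also have "\<dots> \<le> (ennreal (T ^ DIM('a)) * I) epowr (1 / t) * (\<integral>\<^sup>+y. F y epowr s' \<partial>lborel) epowr (1 / s')"
        unfolding I_T[symmetric] using st s'1 ts' by (intro nn_integral_mult_epowr_le) auto
      also have "(ennreal (T ^ DIM('a)) * I) epowr (1 / t) = ennreal (I' powr (1 / t) * T powr (real DIM('a) * (1 - 1 / s')))"
      proof -
        have "T ^ DIM('a) = T powr real DIM('a)"
          using \<open>0 < T\<close> by (simp add: powr_realpow)
        then have "(T ^ DIM('a) * I') powr (1 / t) = I' powr (1 / t) * T powr (real DIM('a) * (1 / t))"
          using I' by (simp add: powr_mult powr_powr mult.commute)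
        then show ?thesis
          using I' \<open>0 < T\<close> by (simp only: I'(1) s'1(2) flip: ennreal_mult) (simp add: ennreal_epowr flip: ennreal_mult)
      qed
      finally show "(\<integral>\<^sup>+y. ennreal (norm (\<Omega>' y)) * F y * indicator (ball 0 T) y \<partial>lborel) \<le>
        ennreal (I' powr (1 / t) * T powr (real DIM('a) * (1 - 1 / s'))) * (\<integral>\<^sup>+y. F y epowr s' \<partial>lborel) epowr (1 / s')" .
    qed simp
  qed
qed

subsection \<open>Decomposition of the kernel into dyadic shells\<close>

lemma norm_le_sum_norm: "norm y \<le> sum_norm y"
  unfolding sum_norm_def norm_vec_def by (intro L2_set_le_sum) auto

lemma norm_nth_le_sum_norm: "norm (y $ i) \<le> sum_norm y"
  unfolding sum_norm_def by (rule member_le_sum) auto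

lemma borel_measurable_sum_norm [measurable]: "sum_norm \<in> borel_measurable borel"
  unfolding sum_norm_def[abs_def] by measurable

lemma frac_integrand_measurable [measurable]:
  assumes [measurable]: "\<Omega> \<in> borel_measurable borel" "\<And>i. f i \<in> borel_measurable borel"
  shows "(\<lambda>(x, y). frac_integrand \<Omega> \<alpha> f x y) \<in> borel_measurable (borel \<Otimes>\<^sub>M borel)"
  unfolding frac_integrand_def by measurable

lemma nn_integral_cube_eq_cube_avg:
  fixes z :: "real ^ 'n"
  assumes "0 < \<rho>"
  shows "(\<integral>\<^sup>+x. F x * indicator (cube z \<rho>) x \<partial>lborel) = ennreal ((2 * \<rho>) ^ CARD('n)) * cube_avg \<rho> F z"
  unfolding cube_avg_def using assms by (simp add: mult.assoc[symmetric] ennreal_mult[symmetric])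

lemma ex_dyadic_scale:
  fixes t :: real
  assumes "0 < t"
  shows "\<exists>j::int. 2 powr (of_int j - 1) \<le> t \<and> t < 2 powr of_int j"
proof (intro exI conjI)
  let ?j = "\<lfloor>log 2 t\<rfloor> + 1"
  show "2 powr (of_int ?j - 1) \<le> t"
    using assms by (subst powr_le_iff) auto
  show "t < 2 powr of_int ?j"
    using assms by (subst less_powr_iff) (auto intro: floor_less_iff[THEN iffD1])
qed

text \<open>Every y with \<open>sum_norm y > 0\<close> lies in a shell between 2 powr (j - 1) and 2
  powr j, and the term of that j alone bounds the integrand; 2 powr \<beta> comes from the lower
  edge. The Euclidean ball contains the region \<open>sum_norm y < 2 powr j\<close>, and its
  indicator gives the terms the form of the estimate for the kernel.\<close>

lemma ennreal_norm_frac_integrand_le: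
  fixes \<Omega> :: "real ^ 'n ^ 'm \<Rightarrow> complex" and \<alpha> :: real
  defines "\<beta> \<equiv> real CARD('m) * real CARD('n) - \<alpha>"
  assumes "0 < \<beta>"
  shows "ennreal (norm (frac_integrand \<Omega> \<alpha> f x y)) \<le>
    (\<integral>\<^sup>+j. ennreal (2 powr \<beta> * 2 powr (- \<beta> * of_int j)) * (ennreal (norm (\<Omega> y)) *
      ((\<Prod>i\<in>UNIV. ennreal (norm (f i (x - y $ i)))) * indicator {y. sum_norm y < 2 powr of_int j} y) *
      indicator (ball 0 (2 powr of_int j)) y) \<partial>count_space (UNIV :: int set))"
proof (cases "sum_norm y = 0")
  \<comment> \<open>Division by zero yields 0, so the integrand vanishes at the singular
    point.\<close>
  case True
  then show ?thesis
    by (simp add: frac_integrand_def)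
next
  case False
  have "0 \<le> sum_norm y"
    by (simp add: sum_norm_def sum_nonneg)
  with False have pos: "0 < sum_norm y"
    by simp
  then obtain j :: int where j: "2 powr (of_int j - 1) \<le> sum_norm y" "sum_norm y < 2 powr of_int j"
    using ex_dyadic_scale by blast
  have "norm (\<Omega> y) / sum_norm y powr \<beta> \<le> norm (\<Omega> y) / (2 powr (of_int j - 1)) powr \<beta>"
    using j assms(2) by (intro divide_left_mono powr_mono2 mult_pos_pos) (auto intro: less_imp_le pos)
  also have "\<dots> = 2 powr \<beta> * 2 powr (- \<beta> * of_int j) * norm (\<Omega> y)"
  proof -
    have "(of_int j - 1) * \<beta> + (\<beta> + - \<beta> * of_int j) = 0"
      by (simp add: algebra_simps)
    then have "(2 powr (of_int j - 1)) powr \<beta> * (2 powr \<beta> * 2 powr (- \<beta> * of_int j)) = 1"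
      by (simp only: powr_powr powr_add[symmetric]) simp
    moreover have "(2 powr (of_int j - 1)) powr \<beta> \<noteq> 0"
      by simp
    ultimately have "2 powr \<beta> * 2 powr (- \<beta> * of_int j) = 1 / (2 powr (of_int j - 1)) powr \<beta>"
      by (metis nonzero_eq_divide_eq mult.commute)
    then show ?thesis
      by (simp only: mult_1_left times_divide_eq_left)
  qed
  finally have le: "norm (\<Omega> y) / sum_norm y powr \<beta> \<le> 2 powr \<beta> * 2 powr (- \<beta> * of_int j) * norm (\<Omega> y)" .
  have "ennreal (norm (frac_integrand \<Omega> \<alpha> f x y)) =
      ennreal (norm (\<Omega> y) / sum_norm y powr \<beta>) * (\<Prod>i\<in>UNIV. ennreal (norm (f i (x - y $ i))))"
    unfolding frac_integrand_def \<beta>_def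
    by (simp add: norm_mult norm_divide prod_norm[symmetric] prod_ennreal ennreal_mult[symmetric] prod_nonneg)
  also have "\<dots> \<le> ennreal (2 powr \<beta> * 2 powr (- \<beta> * of_int j) * norm (\<Omega> y)) * (\<Prod>i\<in>UNIV. ennreal (norm (f i (x - y $ i))))"
    by (intro mult_right_mono ennreal_leI le) auto
  also have "\<dots> = ennreal (2 powr \<beta> * 2 powr (- \<beta> * of_int j)) * (ennreal (norm (\<Omega> y)) *
      ((\<Prod>i\<in>UNIV. ennreal (norm (f i (x - y $ i)))) * indicator {y. sum_norm y < 2 powr of_int j} y) *
      indicator (ball 0 (2 powr of_int j)) y)"
    using j(2) norm_le_sum_norm[of y] by (simp add: ennreal_mult mult.assoc)
  also have "\<dots> \<le> (\<integral>\<^sup>+j. ennreal (2 powr \<beta> * 2 powr (- \<beta> * of_int j)) * (ennreal (norm (\<Omega> y)) *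
      ((\<Prod>i\<in>UNIV. ennreal (norm (f i (x - y $ i)))) * indicator {y. sum_norm y < 2 powr of_int j} y) *
      indicator (ball 0 (2 powr of_int j)) y) \<partial>count_space (UNIV :: int set))"
    by (rule nn_integral_ge_point) simp
  finally show ?thesis .
qed

text \<open>On the region \<open>sum_norm y < \<rho>\<close> every x - y_i lies in
  \<open>cube x \<rho>\<close>. Enlarging the region to the product of these cubes makes the
  integral factorise.\<close>

lemma nn_integral_shell_le:
  fixes f :: "'m::finite \<Rightarrow> real ^ 'n \<Rightarrow> complex"
  assumes [measurable]: "\<And>i. f i \<in> borel_measurable borel" and "0 < \<rho>" "0 < s'"
  shows "(\<integral>\<^sup>+y. ((\<Prod>i\<in>UNIV. ennreal (norm (f i (x - y $ i)))) * indicator {y. sum_norm y < \<rho>} y) epowr s' \<partial>lborel)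
    \<le> (\<Prod>i\<in>UNIV. ennreal ((2 * \<rho>) ^ CARD('n)) * cube_avg \<rho> (\<lambda>z. ennreal (norm (f i z)) epowr s') x)"
proof -
  have "(\<integral>\<^sup>+y. ((\<Prod>i\<in>UNIV. ennreal (norm (f i (x - y $ i)))) * indicator {y. sum_norm y < \<rho>} y) epowr s' \<partial>lborel) \<le>
    (\<integral>\<^sup>+y. (\<Prod>i\<in>UNIV. ennreal (norm (f i (x - y $ i))) epowr s' * indicator (cube x \<rho>) (x - y $ i)) \<partial>lborel)"
  proof (rule nn_integral_mono)
    fix y :: "real ^ 'n ^ 'm"
    show "((\<Prod>i\<in>UNIV. ennreal (norm (f i (x - y $ i)))) * indicator {y. sum_norm y < \<rho>} y) epowr s' \<le>
        (\<Prod>i\<in>UNIV. ennreal (norm (f i (x - y $ i))) epowr s' * indicator (cube x \<rho>) (x - y $ i))"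
    proof (cases "sum_norm y < \<rho>")
      case True
      have "x - y $ i \<in> cube x \<rho>" for i
        unfolding mem_cube
      proof
        fix k
        have "\<bar>y $ i $ k\<bar> \<le> norm (y $ i)"
          by (rule component_le_norm_cart)
        also have "\<dots> \<le> \<rho>"
          using norm_nth_le_sum_norm[of y i] True by linarith
        finally show "\<bar>(x - y $ i) $ k - x $ k\<bar> \<le> \<rho>"
          by simp
      qed
      then show ?thesis
        using True by (simp add: epowr_mult prod_epowr)
    qed simp
  qed
  also have "\<dots> = (\<Prod>i\<in>UNIV. \<integral>\<^sup>+z. ennreal (norm (f i z)) epowr s' * indicator (cube x \<rho>) z \<partial>lborel)"
    by (intro nn_integral_lborel_vec_prod_diff) measurable
  also have "\<dots> = (\<Prod>i\<in>UNIV. ennreal ((2 * \<rho>) ^ CARD('n)) * cube_avg \<rho> (\<lambda>z. ennreal (norm (f i z)) epowr s') x)"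
    using assms by (simp add: nn_integral_cube_eq_cube_avg)
  finally show ?thesis .
qed

text \<open>Combines the shell decomposition with the estimate for the kernel. In the constant, 2
  powr (N - \<alpha>) stems from the lower edges of the shells, K from the kernel, and 2 powr (N /
  s') from cubes whose side is twice the radius of the shell.\<close>

lemma nn_integral_frac_integrand_le:
  fixes \<Omega> :: "real ^ 'n ^ 'm \<Rightarrow> complex" and \<alpha> s' K :: real and f :: "'m \<Rightarrow> real ^ 'n \<Rightarrow> complex"
  defines "N \<equiv> real CARD('m) * real CARD('n)"
  assumes "\<alpha> < N" "1 \<le> s'" "0 \<le> K"
    and [measurable]: "\<Omega> \<in> borel_measurable borel" "\<And>i. f i \<in> borel_measurable borel"
    and \<Omega>: "\<And>T F. 0 < T \<Longrightarrow> F \<in> borel_measurable borel \<Longrightarrow>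
      (\<integral>\<^sup>+y. ennreal (norm (\<Omega> y)) * F y * indicator (ball 0 T) y \<partial>lborel)
        \<le> ennreal (K * T powr (N * (1 - 1 / s'))) * (\<integral>\<^sup>+y. F y epowr s' \<partial>lborel) epowr (1 / s')"
  shows "(\<integral>\<^sup>+y. ennreal (norm (frac_integrand \<Omega> \<alpha> f x y)) \<partial>lborel) \<le>
    ennreal (2 powr (N - \<alpha>) * K * 2 powr (N / s')) *
    (\<integral>\<^sup>+j. (\<Prod>i\<in>UNIV. (ennreal (2 powr (\<alpha> * s' / real CARD('m) * of_int j)) *
      cube_avg (2 powr of_int j) (\<lambda>z. ennreal (norm (f i z)) epowr s') x) epowr (1 / s')) \<partial>count_space (UNIV :: int set))"
proof -
  define \<beta> where "\<beta> = N - \<alpha>"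
  have \<beta>: "0 < \<beta>"
    using assms by (simp add: \<beta>_def)
  let ?c = "\<lambda>j. ennreal (2 powr \<beta> * 2 powr (- \<beta> * of_int j))"
  let ?F = "\<lambda>(j::int) y. (\<Prod>i\<in>UNIV. ennreal (norm (f i (x - y $ i)))) * indicator {y. sum_norm y < 2 powr of_int j} y"
  let ?A = "\<lambda>(j::int) i. cube_avg (2 powr of_int j) (\<lambda>z. ennreal (norm (f i z)) epowr s') x"
  have [measurable]: "ball 0 T \<in> sets (borel :: (real ^ 'n ^ 'm) measure)" for T
    by simp
  have "(\<integral>\<^sup>+y. ennreal (norm (frac_integrand \<Omega> \<alpha> f x y)) \<partial>lborel) \<le>
    (\<integral>\<^sup>+y. \<integral>\<^sup>+j. ?c j * (ennreal (norm (\<Omega> y)) * ?F j y * indicator (ball 0 (2 powr of_int j)) y)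
      \<partial>count_space (UNIV :: int set) \<partial>lborel)"
    unfolding \<beta>_def N_def using \<beta>
    by (intro nn_integral_mono ennreal_norm_frac_integrand_le) (simp add: \<beta>_def N_def)
  also have "\<dots> = (\<integral>\<^sup>+j. ?c j * (\<integral>\<^sup>+y. ennreal (norm (\<Omega> y)) * ?F j y * indicator (ball 0 (2 powr of_int j)) y \<partial>lborel)
      \<partial>count_space (UNIV :: int set))"
    by (subst nn_integral_count_space_nn_integral) (auto simp: nn_integral_cmult)
  also have "\<dots> \<le> (\<integral>\<^sup>+j. ennreal (2 powr \<beta> * K * 2 powr (N / s')) *
      (\<Prod>i\<in>UNIV. (ennreal (2 powr (\<alpha> * s' / real CARD('m) * of_int j)) * ?A j i) epowr (1 / s'))
      \<partial>count_space (UNIV :: int set))"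
  proof (rule nn_integral_mono)
    fix j :: int
    let ?\<rho> = "2 powr of_int j :: real"
    have "(\<integral>\<^sup>+y. ennreal (norm (\<Omega> y)) * ?F j y * indicator (ball 0 ?\<rho>) y \<partial>lborel) \<le>
        ennreal (K * ?\<rho> powr (N * (1 - 1 / s'))) * (\<integral>\<^sup>+y. ?F j y epowr s' \<partial>lborel) epowr (1 / s')"
      by (intro \<Omega>) auto
    also have "\<dots> \<le> ennreal (K * ?\<rho> powr (N * (1 - 1 / s'))) *
        (\<Prod>i\<in>UNIV. ennreal ((2 * ?\<rho>) ^ CARD('n)) * ?A j i) epowr (1 / s')"
      using assms(3) by (intro mult_left_mono epowr_mono nn_integral_shell_le) auto
    also have "(\<Prod>i\<in>UNIV. ennreal ((2 * ?\<rho>) ^ CARD('n)) * ?A j i) epowr (1 / s') =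
        ennreal ((2 * ?\<rho>) powr (N / s')) * (\<Prod>i\<in>UNIV. ?A j i epowr (1 / s'))"
    proof -
      have "ennreal ((2 * ?\<rho>) ^ CARD('n)) epowr (1 / s') = ennreal ((2 * ?\<rho>) powr (real CARD('n) / s'))"
      proof -
        have "((2 * ?\<rho>) ^ CARD('n)) powr (1 / s') = (2 * ?\<rho>) powr (real CARD('n) / s')"
          by (subst powr_realpow[symmetric], simp, simp only: powr_powr, simp)
        then show ?thesis
          by (subst ennreal_epowr) simp_all
      qed
      moreover have "ennreal ((2 * ?\<rho>) powr (real CARD('n) / s')) ^ CARD('m) = ennreal ((2 * ?\<rho>) powr (N / s'))"
        by (simp add: ennreal_power powr_power N_def)
      ultimately show ?thesis
        unfolding prod_epowr epowr_mult prod.distrib by (simp only: prod_constant)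
    qed
    finally have "?c j * (\<integral>\<^sup>+y. ennreal (norm (\<Omega> y)) * ?F j y * indicator (ball 0 ?\<rho>) y \<partial>lborel) \<le>
        ?c j * (ennreal (K * ?\<rho> powr (N * (1 - 1 / s'))) * (ennreal ((2 * ?\<rho>) powr (N / s')) * (\<Prod>i\<in>UNIV. ?A j i epowr (1 / s'))))"
      by (rule mult_left_mono) simp
    also have "\<dots> = ennreal (2 powr \<beta> * K * 2 powr (N / s') *
        (2 powr (- \<beta> * of_int j) * ?\<rho> powr (N * (1 - 1 / s')) * ?\<rho> powr (N / s'))) * (\<Prod>i\<in>UNIV. ?A j i epowr (1 / s'))"
    proof -
      have *: "ennreal a * (ennreal b * (ennreal c * X)) = ennreal (a * (b * c)) * X"
        if "0 \<le> a" "0 \<le> b" "0 \<le> c" for a b c X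
        using that by (simp add: ennreal_mult mult.assoc)
      have "(2 * ?\<rho>) powr (N / s') = 2 powr (N / s') * ?\<rho> powr (N / s')"
        by (simp add: powr_mult)
      then have eq: "2 powr \<beta> * 2 powr (- \<beta> * of_int j) * (K * ?\<rho> powr (N * (1 - 1 / s')) * (2 * ?\<rho>) powr (N / s')) =
        2 powr \<beta> * K * 2 powr (N / s') * (2 powr (- \<beta> * of_int j) * ?\<rho> powr (N * (1 - 1 / s')) * ?\<rho> powr (N / s'))"
        by (simp only: mult_ac)
      show ?thesis
        by (subst *, simp, simp add: assms(4), simp, simp only: eq)
    qed
    \<comment> \<open>Counting powers of the scale: -(N - \<alpha>) from the kernel's size, N (1 - 1
      / s') from its norm on the ball and N / s' from the volumes of the cubes leave exactly
      \<alpha>. Shared among m factors under the power 1 / s', this gives the order \<alpha> s' /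
      m.\<close>
    also have "2 powr (- \<beta> * of_int j) * ?\<rho> powr (N * (1 - 1 / s')) * ?\<rho> powr (N / s') = 2 powr (\<alpha> * of_int j)"
    proof -
      have "- \<beta> * of_int j + of_int j * (N * (1 - 1 / s')) + of_int j * (N / s') = \<alpha> * of_int j"
        by (simp add: \<beta>_def algebra_simps)
      then show ?thesis
        by (simp only: powr_powr powr_add[symmetric])
    qed
    also have "ennreal (2 powr \<beta> * K * 2 powr (N / s') * 2 powr (\<alpha> * of_int j)) * (\<Prod>i\<in>UNIV. ?A j i epowr (1 / s')) =
      ennreal (2 powr \<beta> * K * 2 powr (N / s')) *
      (\<Prod>i\<in>UNIV. (ennreal (2 powr (\<alpha> * s' / real CARD('m) * of_int j)) * ?A j i) epowr (1 / s'))"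
    proof -
      have "ennreal (2 powr (\<alpha> * s' / real CARD('m) * of_int j)) epowr (1 / s') = ennreal (2 powr (\<alpha> / real CARD('m) * of_int j))"
        using assms(3) by (simp add: ennreal_epowr powr_powr)
      moreover have "ennreal (2 powr (\<alpha> / real CARD('m) * of_int j)) ^ CARD('m) = ennreal (2 powr (\<alpha> * of_int j))"
        by (simp add: ennreal_power powr_power)
      ultimately have "(\<Prod>i\<in>UNIV. (ennreal (2 powr (\<alpha> * s' / real CARD('m) * of_int j)) * ?A j i) epowr (1 / s')) =
          ennreal (2 powr (\<alpha> * of_int j)) * (\<Prod>i\<in>UNIV. ?A j i epowr (1 / s'))"
        unfolding epowr_mult prod.distrib by (simp only: prod_constant)
      then show ?thesis
        by (subst ennreal_mult, simp add: assms(4), simp, simp only: mult.assoc)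
    qed
    finally show "?c j * (\<integral>\<^sup>+y. ennreal (norm (\<Omega> y)) * ?F j y * indicator (ball 0 ?\<rho>) y \<partial>lborel) \<le>
      ennreal (2 powr \<beta> * K * 2 powr (N / s')) *
      (\<Prod>i\<in>UNIV. (ennreal (2 powr (\<alpha> * s' / real CARD('m) * of_int j)) * ?A j i) epowr (1 / s'))" .
  qed
  also have "\<dots> = ennreal (2 powr \<beta> * K * 2 powr (N / s')) * (\<integral>\<^sup>+j.
      (\<Prod>i\<in>UNIV. (ennreal (2 powr (\<alpha> * s' / real CARD('m) * of_int j)) * ?A j i) epowr (1 / s'))
      \<partial>count_space (UNIV :: int set))"
    by (intro nn_integral_cmult) auto
  finally show ?thesis
    by (simp add: \<beta>_def)
qed

subsection \<open>The weighted estimate for the rough fractional integral\<close>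

lemma prod_less_top_ennreal:
  "(\<And>i. i \<in> I \<Longrightarrow> f i < (top :: ennreal)) \<Longrightarrow> (\<Prod>i\<in>I. f i) < top"
  by (induction I rule: infinite_finite_induct) (auto simp: ennreal_mult_less_top)

text \<open>The definition of a weight provides integrability on compact sets only, so measurability
  on the whole space is recovered as a limit of truncations to balls.\<close>

lemma weight_borel_version:
  fixes w :: "'a::euclidean_space \<Rightarrow> real"
  assumes "weight w"
  obtains w' where "w' \<in> borel_measurable borel" "AE x in lborel. w x = w' x" "AE x in lborel. 0 < w' x"
proof -
  have "(\<lambda>x. indicator (cball 0 (real k)) x *\<^sub>R w x) \<in> borel_measurable lebesgue" for k
  proof -
    have "set_integrable lebesgue (cball 0 (real k)) w"
      using assms by (simp add: weight_def)
    then show ?thesis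
      unfolding set_integrable_def by (rule borel_measurable_integrable)
  qed
  moreover have "(\<lambda>k. indicator (cball 0 (real k)) x *\<^sub>R w x) \<longlonglongrightarrow> w x" for x
  proof (rule tendsto_eventually)
    obtain k0 where "norm x \<le> real k0"
      using real_arch_simple by blast
    then show "\<forall>\<^sub>F k in sequentially. indicator (cball 0 (real k)) x *\<^sub>R w x = w x"
      by (intro eventually_sequentiallyI[of k0]) (auto simp: indicator_def)
  qed
  ultimately have "w \<in> borel_measurable lebesgue"
    by (rule borel_measurable_LIMSEQ_metric)
  from completion_ex_borel_measurable_real[OF this]
  obtain w' where w': "w' \<in> borel_measurable lborel" "AE x in lborel. w x = w' x"
    by (rule bexE)
  have "AE x in lborel. 0 < w x"
    using assms by (simp add: weight_def AE_completion_iff)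
  with w'(2) have "AE x in lborel. 0 < w' x"
    by eventually_elim simp
  with w' show thesis
    by (intro that[of w']) auto
qed

lemma average_cube_eq_cube_avg:
  fixes z :: "real ^ 'n"
  assumes "0 < \<rho>" "AE x in lborel. ennreal (g x) = F x"
  shows "average (cube z \<rho>) g = cube_avg \<rho> F z"
proof -
  have "(\<integral>\<^sup>+x\<in>cube z \<rho>. ennreal (g x) \<partial>lborel) = (\<integral>\<^sup>+x\<in>cube z \<rho>. F x \<partial>lborel)"
    using assms(2) by (intro nn_integral_cong_AE) auto
  moreover have "inverse (ennreal ((2 * \<rho>) ^ CARD('n))) = ennreal (1 / (2 * \<rho>) ^ CARD('n))"
    using assms(1) by (subst inverse_ennreal) (auto simp: inverse_eq_divide)
  ultimately show ?thesis
    using assms(1)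
    by (simp add: average_def cube_avg_def nn_integral_completion emeasure_cube divide_ennreal_def mult.commute)
qed

lemma AE_frac_integrand_eq:
  fixes \<Omega> :: "real ^ 'n ^ 'm \<Rightarrow> complex"
  assumes "AE y in lborel. \<Omega> y = \<Omega>' y" "\<And>i. AE z in lborel. f i z = f' i z"
  shows "AE y in lborel. frac_integrand \<Omega>' \<alpha> f' x y = frac_integrand \<Omega> \<alpha> f x y"
proof -
  have "AE y in lborel. \<forall>i. f i (x - y $ i) = f' i (x - y $ i)"
    unfolding AE_all_countable using AE_lborel_diff_vec_nth[OF assms(2)] by blast
  with assms(1) show ?thesis
    by eventually_elim (simp add: frac_integrand_def)
qed

text \<open>For each fixed x the integrands differ only on a null set of y. The identities thus hold
  at every x, and measurability of the operator in x can be read off from the jointly measurable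
  Borel integrand.\<close>

lemma frac_integral_eq_borel_version:
  fixes \<Omega> :: "real ^ 'n ^ 'm \<Rightarrow> complex"
  assumes [measurable]: "\<Omega>' \<in> borel_measurable borel" "\<And>i. f' i \<in> borel_measurable borel"
    and "AE y in lborel. \<Omega> y = \<Omega>' y" "\<And>i. AE z in lborel. f i z = f' i z"
  shows "frac_integrand \<Omega> \<alpha> f x \<in> borel_measurable lebesgue"
    "(\<integral>\<^sup>+y. ennreal (norm (frac_integrand \<Omega> \<alpha> f x y)) \<partial>lebesgue) =
      (\<integral>\<^sup>+y. ennreal (norm (frac_integrand \<Omega>' \<alpha> f' x y)) \<partial>lborel)"
    "frac_integral \<Omega> \<alpha> f x = (\<integral>y. frac_integrand \<Omega>' \<alpha> f' x y \<partial>lborel)"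
proof -
  note AE = AE_frac_integrand_eq[of \<Omega> \<Omega>' f f' \<alpha> x, OF assms(3,4)]
  have meas': "frac_integrand \<Omega>' \<alpha> f' x \<in> borel_measurable lborel"
    using measurable_compose[OF measurable_Pair1'[of x borel] frac_integrand_measurable[of \<Omega>' f' \<alpha>]] assms(1,2)
    by simp
  show meas: "frac_integrand \<Omega> \<alpha> f x \<in> borel_measurable lebesgue"
    using AE by (intro borel_measurable_AE[OF measurable_completion[OF meas']]) (simp add: AE_completion_iff)
  show "(\<integral>\<^sup>+y. ennreal (norm (frac_integrand \<Omega> \<alpha> f x y)) \<partial>lebesgue) =
      (\<integral>\<^sup>+y. ennreal (norm (frac_integrand \<Omega>' \<alpha> f' x y)) \<partial>lborel)"
    unfolding nn_integral_completion using AE by (intro nn_integral_cong_AE) auto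
  have "frac_integral \<Omega> \<alpha> f x = (\<integral>y. frac_integrand \<Omega>' \<alpha> f' x y \<partial>lebesgue)"
    unfolding frac_integral_def using AE
    by (intro integral_cong_AE meas measurable_completion meas') (auto simp: AE_completion_iff)
  then show "frac_integral \<Omega> \<alpha> f x = (\<integral>y. frac_integrand \<Omega>' \<alpha> f' x y \<partial>lborel)"
    using integral_completion[OF meas'] by simp
qed

theorem theorem6:
  fixes \<alpha> s' p :: real
    and s :: ennreal
    and \<Omega> :: "real ^ 'n ^ 'm \<Rightarrow> complex"
    and u v :: "real ^ 'n \<Rightarrow> real"
    and q :: "'m \<Rightarrow> real"
  assumes "CARD('n) \<ge> 2"
    and "0 < \<alpha>" "\<alpha> < real CARD('m) * real CARD('n)"
    and "1 < s" "1 / s + 1 / ennreal s' = 1"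
    and "1 \<le> s'" "s' < real CARD('m) * real CARD('n) / \<alpha>"
    and "homogeneous_deg_zero \<Omega>"
    and "in_Lebesgue_space s sphere_measure \<Omega>"
    and "weight u" "weight v"
    and "\<And>i. s' < q i \<and> q i < real CARD('m) * p"
    and "\<And>i. \<exists>r>1. \<exists>C>0. \<forall>Q\<in>cubes.
      ennreal (measure lebesgue Q powr (s' / (real CARD('m) * p)
          + \<alpha> * s' / (real CARD('m) * real CARD('n)) - s' / q i)) *
      average Q (\<lambda>x. u x powr r) epowr (s' / (r * real CARD('m) * p)) *
      average Q (\<lambda>x. v x powr (r * (1 - conj_exponent (q i / s'))))
        epowr (1 / (r * conj_exponent (q i / s')))
      \<le> ennreal C"
  shows "\<exists>C>0. \<forall>f :: 'm \<Rightarrow> real ^ 'n \<Rightarrow> complex.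
    (\<forall>i. f i \<in> weighted_Lp (q i) v) \<longrightarrow>
      (AE x in lebesgue. integrable lebesgue (frac_integrand \<Omega> \<alpha> f x)) \<and>
      frac_integral \<Omega> \<alpha> f \<in> weighted_Lp p u \<and>
      weighted_norm p u (frac_integral \<Omega> \<alpha> f)
        \<le> ennreal C * (\<Prod>i\<in>UNIV. weighted_norm (q i) v (f i))"
proof -
  define m n where "m = real CARD('m)" and "n = real CARD('n)"
  have mn: "0 < m" "0 < n"
    by (auto simp: m_def n_def)
  have s': "0 < s'"
    using assms(6) by simp
  have q: "s' < q i" "q i < m * p" for i
    using assms(12)[of i] by (auto simp: m_def)
  have "0 < m * p"
    using q[of undefined] s' by linarith
  then have p: "0 < p"
    using mn by (simp add: zero_less_mult_iff)
  define P where "P i = q i / s'" for i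
  define R where "R = real CARD('m) * p / s'"
  define a where "a = \<alpha> * s' / real CARD('m)"
  have P: "1 < P i" "P i < R" "q i = s' * P i" for i
    using q[of i] s' by (auto simp: P_def R_def m_def divide_strict_right_mono)
  obtain \<Omega>' K where \<Omega>': "\<Omega>' \<in> borel_measurable borel" "AE y in lborel. \<Omega> y = \<Omega>' y" "0 \<le> K"
    "\<And>T F. 0 < T \<Longrightarrow> F \<in> borel_measurable borel \<Longrightarrow>
      (\<integral>\<^sup>+y. ennreal (norm (\<Omega>' y)) * F y * indicator (ball 0 T) y \<partial>lborel)
        \<le> ennreal (K * T powr (real DIM(real ^ 'n ^ 'm) * (1 - 1 / s'))) * (\<integral>\<^sup>+y. F y epowr s' \<partial>lborel) epowr (1 / s')"
    using homogeneous_Lebesgue_sphere_le[OF assms(4,5,6,8,9)] by blast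
  note [measurable] = \<Omega>'(1)
  obtain u' where u' [measurable]: "u' \<in> borel_measurable borel"
    and u'_eq: "AE x in lborel. u x = u' x" and u'_pos: "AE x in lborel. 0 < u' x"
    using weight_borel_version[OF assms(10)] by blast
  obtain v' where v' [measurable]: "v' \<in> borel_measurable borel"
    and v'_eq: "AE x in lborel. v x = v' x" and v'_pos: "AE x in lborel. 0 < v' x"
    using weight_borel_version[OF assms(11)] by blast
  obtain r where r: "\<And>i. 1 < r i" and "\<And>i. \<exists>C>0. \<forall>Q\<in>cubes.
      ennreal (measure lebesgue Q powr (s' / (real CARD('m) * p)
          + \<alpha> * s' / (real CARD('m) * real CARD('n)) - s' / q i)) *
      average Q (\<lambda>x. u x powr r i) epowr (s' / (r i * real CARD('m) * p)) *
      average Q (\<lambda>x. v x powr (r i * (1 - conj_exponent (q i / s'))))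
        epowr (1 / (r i * conj_exponent (q i / s')))
      \<le> ennreal C"
    using assms(13) by metis
  then obtain C where C: "\<And>i. 0 < C i" and hyp: "\<And>i Q. Q \<in> cubes \<Longrightarrow>
      ennreal (measure lebesgue Q powr (s' / (real CARD('m) * p)
          + \<alpha> * s' / (real CARD('m) * real CARD('n)) - s' / q i)) *
      average Q (\<lambda>x. u x powr r i) epowr (s' / (r i * real CARD('m) * p)) *
      average Q (\<lambda>x. v x powr (r i * (1 - conj_exponent (q i / s'))))
        epowr (1 / (r i * conj_exponent (q i / s')))
      \<le> ennreal (C i)"
    by metis
  define U where "U x = ennreal (u' x)" for x
  \<comment> \<open>With P' conjugate to P, -(1 / P) P' = 1 - P'. Hence the power r P' of
    \<open>k i\<close> is the power of \<upsilon> in the hypothesis.\<close>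
  define k where "k i x = ennreal (v' x powr (- 1 / P i))" for i x
  have [measurable]: "U \<in> borel_measurable borel" "k i \<in> borel_measurable borel" for i
    unfolding U_def[abs_def] k_def[abs_def] by measurable
  have "\<exists>K::real. \<forall>g G. (\<forall>i. g i \<in> borel_measurable borel) \<longrightarrow> (\<forall>i. G i \<in> borel_measurable borel) \<longrightarrow>
    (\<forall>i. AE x in lborel. g i x \<le> G i x * k i x) \<longrightarrow>
    (\<integral>\<^sup>+x. (\<integral>\<^sup>+j. (\<Prod>i\<in>UNIV. (ennreal (2 powr (a * of_int j)) * cube_avg (2 powr of_int j) (g i) x) epowr (1 / s'))
        \<partial>count_space (UNIV :: int set)) epowr p * U x \<partial>lborel)
      \<le> ennreal K * (\<Prod>i\<in>UNIV. (\<integral>\<^sup>+x. G i x epowr P i \<partial>lborel) epowr (p / (s' * P i)))"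
  proof (rule multilinear_two_weight_le[OF P(1,2) r C s' R_def])
    fix i and z :: "real ^ 'n" and \<rho> :: real
    assume \<rho>: "0 < \<rho>"
    have c: "conj_exponent (q i / s') = P i / (P i - 1)"
      by (simp add: conj_exponent_def P_def)
    have e: "s' / (real CARD('m) * p) + \<alpha> * s' / (real CARD('m) * real CARD('n)) - s' / q i =
        1 / R + a / real CARD('n) - 1 / P i"
      by (simp add: R_def a_def P_def)
    have e': "s' / (r i * real CARD('m) * p) = 1 / (r i * R)"
      by (simp add: R_def)
    have "average (cube z \<rho>) (\<lambda>x. u x powr r i) = cube_avg \<rho> (\<lambda>x. U x epowr r i) z"
    proof (rule average_cube_eq_cube_avg[OF \<rho>])
      show "AE x in lborel. ennreal (u x powr r i) = U x epowr r i"
        using u'_eq u'_pos by eventually_elim (simp add: U_def ennreal_epowr)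
    qed
    moreover have "average (cube z \<rho>) (\<lambda>x. v x powr (r i * (1 - P i / (P i - 1)))) =
        cube_avg \<rho> (\<lambda>x. k i x epowr (r i * (P i / (P i - 1)))) z"
    proof (rule average_cube_eq_cube_avg[OF \<rho>])
      have exponent: "r i * (1 - P i / (P i - 1)) = (- 1 / P i) * (r i * (P i / (P i - 1)))"
        using P(1)[of i] by (simp add: field_simps)
      show "AE x in lborel. ennreal (v x powr (r i * (1 - P i / (P i - 1)))) = k i x epowr (r i * (P i / (P i - 1)))"
        unfolding exponent using v'_eq
        by eventually_elim (simp only: k_def ennreal_epowr powr_powr powr_ge_zero)
    qed
    ultimately show "ennreal (((2 * \<rho>) ^ CARD('n)) powr (1 / R + a / real CARD('n) - 1 / P i)) *
        cube_avg \<rho> (\<lambda>x. U x epowr r i) z epowr (1 / (r i * R)) *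
        cube_avg \<rho> (\<lambda>x. k i x epowr (r i * (P i / (P i - 1)))) z epowr (1 / (r i * (P i / (P i - 1)))) \<le> ennreal (C i)"
      using hyp[OF cube_in_cubes[OF \<rho>], of z i] unfolding c e e' measure_cube[OF less_imp_le[OF \<rho>]]
      by (simp only:)
  qed auto
  then obtain K1 :: real where K1: "\<And>g G. (\<And>i. g i \<in> borel_measurable borel) \<Longrightarrow> (\<And>i. G i \<in> borel_measurable borel) \<Longrightarrow>
    (\<And>i. AE x in lborel. g i x \<le> G i x * k i x) \<Longrightarrow>
    (\<integral>\<^sup>+x. (\<integral>\<^sup>+j. (\<Prod>i\<in>UNIV. (ennreal (2 powr (a * of_int j)) * cube_avg (2 powr of_int j) (g i) x) epowr (1 / s'))
        \<partial>count_space (UNIV :: int set)) epowr p * U x \<partial>lborel)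
      \<le> ennreal K1 * (\<Prod>i\<in>UNIV. (\<integral>\<^sup>+x. G i x epowr P i \<partial>lborel) epowr (p / (s' * P i)))"
    by blast
  define K0 where "K0 = 2 powr (m * n - \<alpha>) * K * 2 powr (m * n / s')"
  have K0: "0 \<le> K0"
    using \<Omega>'(3) by (simp add: K0_def)
  define K2 where "K2 = K0 powr p * max 0 K1"
  have K2: "0 \<le> K2"
    by (simp add: K2_def)
  \<comment> \<open>\<open>K2\<close> may be 0; the summand 1 makes the constant positive.\<close>
  define B where "B = K2 powr (1 / p) + 1"
  have B: "0 < B"
    by (simp add: B_def add_nonneg_pos)
  show ?thesis
  proof (intro exI[of _ B] conjI allI impI B)
    fix f :: "'m \<Rightarrow> real ^ 'n \<Rightarrow> complex"
    assume f: "\<forall>i. f i \<in> weighted_Lp (q i) v"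
    define N where "N i = (\<integral>\<^sup>+x. ennreal (norm (f i x) powr q i * v x) \<partial>lborel)" for i
    have norm_f: "weighted_norm (q i) v (f i) = N i epowr (1 / q i)" for i
      by (simp add: weighted_norm_def N_def nn_integral_completion)
    have N_fin: "N i < \<infinity>" for i
      using f[rule_format, of i] norm_f[of i] by (simp add: weighted_Lp_def)
    have "\<exists>f'\<in>borel_measurable lborel. AE x in lborel. f i x = f' x" for i
      using f by (intro completion_ex_borel_measurable_complex) (simp add: weighted_Lp_def)
    then have "\<forall>i. \<exists>f'. f' \<in> borel_measurable lborel \<and> (AE x in lborel. f i x = f' x)"
      unfolding Bex_def by (intro allI)
    from choice[OF this] obtain f' where f'_all: "\<forall>i. f' i \<in> borel_measurable lborel \<and> (AE x in lborel. f i x = f' i x)"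
      by (rule exE)
    then have f' [measurable]: "f' i \<in> borel_measurable borel" for i
      by simp
    from f'_all have f'_eq: "AE x in lborel. f i x = f' i x" for i
      by blast
    define g where "g i x = ennreal (norm (f' i x)) epowr s'" for i x
    \<comment> \<open>Since s' P = q, the power \<open>P i\<close> of \<open>G i\<close> is the
      integrand of the weighted norm of \<open>f i\<close>, so these norms come out exactly.\<close>
    define G where "G i x = g i x * ennreal (v' x powr (1 / P i))" for i x
    have [measurable]: "g i \<in> borel_measurable borel" "G i \<in> borel_measurable borel" for i
      unfolding g_def[abs_def] G_def[abs_def] by measurable
    have gG: "AE x in lborel. g i x \<le> G i x * k i x" for i
      using v'_pos
    proof eventually_elim
      case (elim x)
      have "ennreal (v' x powr (1 / P i)) * ennreal (v' x powr (- 1 / P i)) = 1"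
        using elim by (simp flip: ennreal_mult powr_add)
      then show ?case
        by (simp add: G_def k_def mult.assoc)
    qed
    have G_N: "(\<integral>\<^sup>+x. G i x epowr P i \<partial>lborel) = N i" for i
      unfolding N_def
    proof (rule nn_integral_cong_AE)
      show "AE x in lborel. G i x epowr P i = ennreal (norm (f i x) powr q i * v x)"
        using v'_pos v'_eq f'_eq[of i]
      proof eventually_elim
        case (elim x)
        have "ennreal (v' x powr (1 / P i)) epowr P i = ennreal (v' x)"
          using elim P(1)[of i] by (simp add: ennreal_epowr powr_powr)
        then show ?case
          using elim by (simp add: G_def g_def epowr_mult epowr_epowr ennreal_epowr P(3) ennreal_mult powr_powr)
      qed
    qed
    define S where "S x = (\<integral>\<^sup>+j. (\<Prod>i\<in>UNIV. (ennreal (2 powr (a * of_int j)) * cube_avg (2 powr of_int j) (g i) x) epowr (1 / s'))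
        \<partial>count_space (UNIV :: int set))" for x
    have [measurable]: "S \<in> borel_measurable borel"
      unfolding S_def[abs_def] by measurable
    define J where "J x = (\<integral>\<^sup>+y. ennreal (norm (frac_integrand \<Omega>' \<alpha> f' x y)) \<partial>lborel)" for x
    have J_S: "J x \<le> ennreal K0 * S x" for x
      unfolding J_def S_def K0_def m_def n_def a_def g_def[abs_def]
      using \<Omega>' assms(3,6) by (intro nn_integral_frac_integrand_le) auto
    have borel: "frac_integrand \<Omega> \<alpha> f x \<in> borel_measurable lebesgue"
      "(\<integral>\<^sup>+y. ennreal (norm (frac_integrand \<Omega> \<alpha> f x y)) \<partial>lebesgue) = J x"
      "frac_integral \<Omega> \<alpha> f x = (\<integral>y. frac_integrand \<Omega>' \<alpha> f' x y \<partial>lborel)" for x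
      unfolding J_def by (rule frac_integral_eq_borel_version; fact \<Omega>' f' f'_eq)+
    have [measurable]: "J \<in> borel_measurable borel"
      unfolding J_def[abs_def] by measurable
    have "(\<integral>\<^sup>+x. J x epowr p * U x \<partial>lborel) \<le> (\<integral>\<^sup>+x. ennreal (K0 powr p) * (S x epowr p * U x) \<partial>lborel)"
    proof (rule nn_integral_mono)
      fix x
      have "J x epowr p \<le> ennreal (K0 powr p) * S x epowr p"
        using epowr_mono[OF J_S[of x], of p] p K0 by (simp add: epowr_mult ennreal_epowr)
      from mult_right_mono[OF this, of "U x"] show "J x epowr p * U x \<le> ennreal (K0 powr p) * (S x epowr p * U x)"
        by (simp add: mult.assoc)
    qed
    also have "\<dots> = ennreal (K0 powr p) * (\<integral>\<^sup>+x. S x epowr p * U x \<partial>lborel)"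
      by (intro nn_integral_cmult) auto
    also have "\<dots> \<le> ennreal (K0 powr p) * (ennreal (max 0 K1) * (\<Prod>i\<in>UNIV. N i epowr (p / q i)))"
    proof (rule mult_left_mono)
      have "ennreal (max 0 K1) = ennreal K1"
        by (simp add: max_def ennreal_neg)
      then show "(\<integral>\<^sup>+x. S x epowr p * U x \<partial>lborel) \<le> ennreal (max 0 K1) * (\<Prod>i\<in>UNIV. N i epowr (p / q i))"
        using K1[of g G] gG unfolding S_def G_N P(3) by simp
    qed simp
    also have "\<dots> = ennreal K2 * (\<Prod>i\<in>UNIV. N i epowr (p / q i))"
      by (simp add: K2_def ennreal_mult mult.assoc)
    finally have J_le: "(\<integral>\<^sup>+x. J x epowr p * U x \<partial>lborel) \<le> ennreal K2 * (\<Prod>i\<in>UNIV. N i epowr (p / q i))" .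
    have "(\<Prod>i\<in>UNIV. N i epowr (p / q i)) < top"
      using N_fin by (intro prod_less_top_ennreal) simp
    then have "ennreal K2 * (\<Prod>i\<in>UNIV. N i epowr (p / q i)) < top"
      by (simp add: ennreal_mult_less_top)
    with J_le have J_fin: "(\<integral>\<^sup>+x. J x epowr p * U x \<partial>lborel) < top"
      by (rule le_less_trans)
    \<comment> \<open>As u is positive almost everywhere, finiteness of the weighted integral of
      \<open>J\<close> forces \<open>J\<close> itself to be finite almost everywhere, which is
      absolute convergence.\<close>
    then have "AE x in lborel. J x epowr p * U x \<noteq> top"
      using nn_integral_PInf_AE[of "\<lambda>x. J x epowr p * U x" lborel] by (simp add: less_top)
    then have J_AE: "AE x in lborel. J x < top"
      using u'_pos
    proof eventually_elim
      case (elim x)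
      then have "U x \<noteq> 0"
        by (simp add: U_def)
      with elim(1) show ?case
        by (auto simp: ennreal_mult_less_top less_top)
    qed
    show "AE x in lebesgue. integrable lebesgue (frac_integrand \<Omega> \<alpha> f x)"
      unfolding AE_completion_iff using J_AE
    proof eventually_elim
      case (elim x)
      then show ?case
        unfolding integrable_iff_bounded using borel(1,2)[of x] by simp
    qed
    \<comment> \<open>True at every x: where the integrand is not integrable, the Bochner integral
      is 0 by convention.\<close>
    have I_J: "ennreal (norm (frac_integral \<Omega> \<alpha> f x)) \<le> J x" for x
    proof (cases "integrable lebesgue (frac_integrand \<Omega> \<alpha> f x)")
      case True
      from integral_norm_bound_ennreal[OF this] show ?thesis
        by (simp add: borel(2) flip: frac_integral_def)
    qed (simp add: frac_integral_def not_integrable_integral_eq)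
    have "weighted_norm p u (frac_integral \<Omega> \<alpha> f) \<le> (\<integral>\<^sup>+x. J x epowr p * U x \<partial>lborel) epowr (1 / p)"
      unfolding weighted_norm_def nn_integral_completion
    proof (intro epowr_mono nn_integral_mono_AE)
      show "AE x in lborel. ennreal (norm (frac_integral \<Omega> \<alpha> f x) powr p * u x) \<le> J x epowr p * U x"
        using u'_eq u'_pos
      proof eventually_elim
        case (elim x)
        have "ennreal (norm (frac_integral \<Omega> \<alpha> f x) powr p * u x) = ennreal (norm (frac_integral \<Omega> \<alpha> f x)) epowr p * U x"
          using elim by (simp add: ennreal_epowr U_def ennreal_mult)
        also have "\<dots> \<le> J x epowr p * U x"
          using p by (intro mult_right_mono epowr_mono I_J) auto
        finally show ?case .
      qed
    qed (use p in simp)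
    also have "\<dots> \<le> (ennreal K2 * (\<Prod>i\<in>UNIV. N i epowr (p / q i))) epowr (1 / p)"
      using p by (intro epowr_mono J_le) simp
    also have "\<dots> = ennreal (K2 powr (1 / p)) * (\<Prod>i\<in>UNIV. weighted_norm (q i) v (f i))"
      using p K2 by (simp add: epowr_mult prod_epowr epowr_epowr norm_f ennreal_epowr)
    also have "\<dots> \<le> ennreal B * (\<Prod>i\<in>UNIV. weighted_norm (q i) v (f i))"
      by (intro mult_right_mono ennreal_leI) (simp_all add: B_def)
    finally show norm_le: "weighted_norm p u (frac_integral \<Omega> \<alpha> f) \<le> ennreal B * (\<Prod>i\<in>UNIV. weighted_norm (q i) v (f i))" .
    have "(\<Prod>i\<in>UNIV. weighted_norm (q i) v (f i)) < top"
      using N_fin by (intro prod_less_top_ennreal) (simp add: norm_f)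
    then have "ennreal B * (\<Prod>i\<in>UNIV. weighted_norm (q i) v (f i)) < top"
      by (simp add: ennreal_mult_less_top)
    with norm_le have "weighted_norm p u (frac_integral \<Omega> \<alpha> f) < top"
      by (rule le_less_trans)
    moreover have "frac_integral \<Omega> \<alpha> f \<in> borel_measurable lebesgue"
    proof -
      have "(\<lambda>x. \<integral>y. frac_integrand \<Omega>' \<alpha> f' x y \<partial>lborel) \<in> borel_measurable lborel"
        by measurable
      then show ?thesis
        unfolding borel(3)[abs_def] by (rule measurable_completion)
    qed
    ultimately show "frac_integral \<Omega> \<alpha> f \<in> weighted_Lp p u"
      by (simp add: weighted_Lp_def)
  qed
qed

end
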